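(* The indefinite octonionic projective plane $\mathbb OP^{(1,1)}$ with the semi-Riemannian metric $g$ below is homogeneous, i.e. its isometry group acts transitively.
   Context: Octonions $\mathbb O=\mathbb H\oplus\mathbb H$ with product $(q_1,q_2)(p_1,p_2)=(q_1p_1-\bar p_2q_2,\ p_2q_1+q_2\bar p_1)$, conjugation $\overline{(q_1,q_2)}=(\bar q_1,-q_2)$, $\langle a,b\rangle=\mathrm{Re}(a\bar b)$, $|a|^2=\langle a,a\rangle$. $\mathbb OP^{(1,1)}=(U_1\cup U_2)/_\sim$ with $U_1=\{(1,u,v):1+|u|^2-|v|^2>0\}$, $U_2=\{(u,1,v):|u|^2+1-|v|^2>0\}$ and $[a,b,c]\sim[d,e,f]$ iff $(a,b,c)=(d\lambda,e\lambda,f\lambda)$ for some $\lambda\in\mathbb O\setminus\{0\}$; charts $[1,u,v]\mapsto(u,v)$, $[u,1,v]\mapsto(u,v)$. The metric $g$ (of signature $(8,8)$) on each chart, for tangent vector $(du,dv)=(\xi,\eta)$: $ds^2=\frac{|\xi|^2(1-|v|^2)-|\eta|^2(1+|u|^2)+2\mathrm{Re}[(u\bar v)(\eta\bar\xi)]}{(1+|u|^2-|v|^2)^2}$. *)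

theory Defs
  imports "HOL-Analysis.Analysis"
begin

section \<open>Quaternions (a + b i + c j + d k as a 4-tuple of reals)\<close>

type_synonym quat = "real \<times> real \<times> real \<times> real"

fun qmul :: "quat \<Rightarrow> quat \<Rightarrow> quat" where
  "qmul (a1, b1, c1, d1) (a2, b2, c2, d2) =
     (a1*a2 - b1*b2 - c1*c2 - d1*d2,
      a1*b2 + b1*a2 + c1*d2 - d1*c2,
      a1*c2 - b1*d2 + c1*a2 + d1*b2,
      a1*d2 + b1*c2 - c1*b2 + d1*a2)"

fun qconj :: "quat \<Rightarrow> quat" where
  "qconj (a, b, c, d) = (a, -b, -c, -d)"

fun qre :: "quat \<Rightarrow> real" where
  "qre (a, b, c, d) = a"

section \<open>Octonions O = H + H (Cayley--Dickson, as in the paper)\<close>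

type_synonym oct = "quat \<times> quat"

fun omul :: "oct \<Rightarrow> oct \<Rightarrow> oct" where
  "omul (q1, q2) (p1, p2) =
     (qmul q1 p1 - qmul (qconj p2) q2, qmul p2 q1 + qmul q2 (qconj p1))"

fun oconj :: "oct \<Rightarrow> oct" where
  "oconj (q1, q2) = (qconj q1, - q2)"

definition ore :: "oct \<Rightarrow> real" where
  "ore a = qre (fst a)"

definition oone :: oct where
  "oone = ((1, 0, 0, 0), (0, 0, 0, 0))"

definition oinner :: "oct \<Rightarrow> oct \<Rightarrow> real" where
  "oinner a b = ore (omul a (oconj b))"

definition onorm2 :: "oct \<Rightarrow> real" where
  "onorm2 a = oinner a a"

type_synonym triple = "oct \<times> oct \<times> oct"

definition U1 :: "triple set" where
  "U1 = {(oone, u, v) | u v. 1 + onorm2 u - onorm2 v > 0}"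

definition U2 :: "triple set" where
  "U2 = {(u, oone, v) | u v. onorm2 u + 1 - onorm2 v > 0}"

definition oprel :: "(triple \<times> triple) set" where
  "oprel = {(p, q). p \<in> U1 \<union> U2 \<and> q \<in> U1 \<union> U2 \<and>
              (\<exists>l. l \<noteq> 0 \<and> p = (omul (fst q) l, omul (fst (snd q)) l, omul (snd (snd q)) l))}"

definition OP11 :: "triple set set" where
  "OP11 = (U1 \<union> U2) // oprel"

definition chart_dom :: "nat \<Rightarrow> (oct \<times> oct) set" where
  "chart_dom i = (if i = 1 then {(u, v). 1 + onorm2 u - onorm2 v > 0}
                  else {(u, v). onorm2 u + 1 - onorm2 v > 0})"

definition chart_inv :: "nat \<Rightarrow> oct \<times> oct \<Rightarrow> triple set" where
  "chart_inv i w = oprel `` {if i = 1 then (oone, fst w, snd w) else (fst w, oone, snd w)}"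

definition chart :: "nat \<Rightarrow> triple set \<Rightarrow> oct \<times> oct" where
  "chart i X = (THE w. w \<in> chart_dom i \<and> chart_inv i w = X)"

text \<open>The metric g in either chart, as a quadratic form on tangent vectors (du,dv) = (xi,eta).\<close>
definition gform :: "oct \<times> oct \<Rightarrow> oct \<times> oct \<Rightarrow> real" where
  "gform w t = (let u = fst w; v = snd w; xi = fst t; eta = snd t in
     (onorm2 xi * (1 - onorm2 v) - onorm2 eta * (1 + onorm2 u)
       + 2 * ore (omul (omul u (oconj v)) (omul eta (oconj xi))))
     / (1 + onorm2 u - onorm2 v)^2)"

inductive iter_deriv :: "'a::real_normed_vector set \<Rightarrow> ('a \<Rightarrow> 'b::real_normed_vector) \<Rightarrow> ('a \<Rightarrow> 'b) \<Rightarrow> bool"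
  for S f where
  base: "iter_deriv S f f"
| step: "iter_deriv S f g \<Longrightarrow> (\<And>x. x \<in> S \<Longrightarrow> (g has_derivative D x) (at x))
         \<Longrightarrow> iter_deriv S f (\<lambda>x. D x v)"

definition Cinf_on :: "'a::real_normed_vector set \<Rightarrow> ('a \<Rightarrow> 'b::real_normed_vector) \<Rightarrow> bool" where
  "Cinf_on S f \<longleftrightarrow> open S \<and> (\<forall>g. iter_deriv S f g \<longrightarrow> (\<forall>x\<in>S. g differentiable (at x)))"

definition loc_dom :: "(triple set \<Rightarrow> triple set) \<Rightarrow> nat \<Rightarrow> nat \<Rightarrow> (oct \<times> oct) set" where
  "loc_dom F i j = {w \<in> chart_dom i. F (chart_inv i w) \<in> chart_inv j ` chart_dom j}"

definition loc_rep :: "(triple set \<Rightarrow> triple set) \<Rightarrow> nat \<Rightarrow> nat \<Rightarrow> oct \<times> oct \<Rightarrow> oct \<times> oct" where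
  "loc_rep F i j w = chart j (F (chart_inv i w))"

text \<open>F is a smooth self-map of OP^(1,1): maps OP^(1,1) into itself, is continuous
  (preimages of chart domains are open) and all chart representations are C^infinity.\<close>
definition smooth_map :: "(triple set \<Rightarrow> triple set) \<Rightarrow> bool" where
  "smooth_map F \<longleftrightarrow> F ` OP11 \<subseteq> OP11 \<and>
     (\<forall>i\<in>{1,2}. \<forall>j\<in>{1,2}. Cinf_on (loc_dom F i j) (loc_rep F i j))"

definition isometry :: "(triple set \<Rightarrow> triple set) \<Rightarrow> bool" where
  "isometry F \<longleftrightarrow> bij_betw F OP11 OP11 \<and> smooth_map F \<and> smooth_map (inv_into OP11 F) \<and>
     (\<forall>i\<in>{1,2}. \<forall>j\<in>{1,2}. \<forall>w\<in>loc_dom F i j. \<exists>D.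
        (loc_rep F i j has_derivative D) (at w) \<and>
        (\<forall>t. gform (loc_rep F i j w) (D t) = gform w t))"

end

theory Submission
  imports Defs
begin

text \<open>Send \<open>[a, b, c]\<close> to the Hermitian matrix with entries \<open>|a|\<^sup>2, |b|\<^sup>2, |c|\<^sup>2, b a\<^sup>*, c a\<^sup>*, c b\<^sup>*\<close>
  divided by \<open>|a|\<^sup>2 + |b|\<^sup>2 - |c|\<^sup>2\<close>. This embeds the plane as a set of rank one matrices into a
  27-dimensional real vector space, and \<open>g\<close> is the pullback of a quadratic form on that space.
  Hence every linear automorphism of the vector space which preserves the image and the quadratic
  form induces an isometry, with rational local representations. Three families suffice for
  transitivity: real rotations in the first two coordinates, real boosts in the first and third
  coordinate, and \<open>(x, y, z) \<mapsto> (a\<^sup>* x, a y, a z a)\<close> for unit octonions \<open>a\<close>, which is compatible with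
  the products of the entries by the Moufang identities. The last family makes \<open>x\<close> real, a rotation
  then moves the point to \<open>[1, 0, v]\<close>, the last family makes \<open>v\<close> real, and a boost
  moves the point to \<open>[1, 0, 0]\<close>.\<close>

section \<open>Octonions\<close>

notation omul (infixl "\<odot>" 70)

lemma oct_cases:
  obtains a b c d e f g h where "(x :: oct) = ((a, b, c, d), (e, f, g, h))"
  by (metis surj_pair)

lemma oinner_eq_inner: "oinner a b = a \<bullet> b"
  by (cases a rule: oconj.cases; cases b rule: oconj.cases)
     (auto simp: oinner_def ore_def)

lemma onorm2_eq_inner: "onorm2 a = a \<bullet> a"
  by (simp add: onorm2_def oinner_eq_inner)

lemma ore_eq_inner: "ore a = a \<bullet> oone"
  by (cases a) (auto simp: ore_def oone_def)

lemma bounded_linear_oconj: "bounded_linear oconj"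
proof -
  have "linear oconj"
    by (rule linearI) auto
  thus ?thesis by (simp add: linear_conv_bounded_linear)
qed

lemma bounded_bilinear_omul: "bounded_bilinear omul"
proof -
  have "linear (\<lambda>b. a \<odot> b)" for a
    by (rule linearI) (cases a; auto simp: algebra_simps)+
  moreover have "linear (\<lambda>a. a \<odot> b)" for b
    by (rule linearI) (cases b; auto simp: algebra_simps)+
  ultimately show ?thesis
    by (simp add: bilinear_conv_bounded_bilinear [symmetric] bilinear_def)
qed

lemmas oconj_linear [simp] =
  linear_add [OF bounded_linear.linear [OF bounded_linear_oconj]]
  linear_diff [OF bounded_linear.linear [OF bounded_linear_oconj]]
  linear_neg [OF bounded_linear.linear [OF bounded_linear_oconj]]
  linear_scale [OF bounded_linear.linear [OF bounded_linear_oconj]]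
  linear_0 [OF bounded_linear.linear [OF bounded_linear_oconj]]

lemmas omul_scaleR [simp] =
  bounded_bilinear.scaleR_left [OF bounded_bilinear_omul]
  bounded_bilinear.scaleR_right [OF bounded_bilinear_omul]
  bounded_bilinear.zero_left [OF bounded_bilinear_omul]
  bounded_bilinear.zero_right [OF bounded_bilinear_omul]
  bounded_bilinear.minus_left [OF bounded_bilinear_omul]
  bounded_bilinear.minus_right [OF bounded_bilinear_omul]

lemmas omul_distrib =
  bounded_bilinear.add_left [OF bounded_bilinear_omul]
  bounded_bilinear.add_right [OF bounded_bilinear_omul]
  bounded_bilinear.diff_left [OF bounded_bilinear_omul]
  bounded_bilinear.diff_right [OF bounded_bilinear_omul]

lemma oconj_oconj [simp]: "oconj (oconj a) = a"
  by (cases a) auto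

lemma oconj_oone [simp]: "oconj oone = oone"
  by (simp add: oone_def)

lemma omul_oone [simp]: "oone \<odot> a = a" "a \<odot> oone = a"
  by (cases a rule: oct_cases; simp add: oone_def)+

lemma oone_inner_oone [simp]: "oone \<bullet> oone = 1"
  by (simp add: oone_def)

lemma oone_neq_0 [simp]: "oone \<noteq> 0"
  using oone_inner_oone by fastforce

lemma oconj_omul [simp]: "oconj (a \<odot> b) = oconj b \<odot> oconj a"
  by (cases a rule: oct_cases; cases b rule: oct_cases) (simp add: algebra_simps)

lemma inner_oconj_oconj [simp]: "oconj a \<bullet> oconj b = a \<bullet> b"
  by (cases a rule: oct_cases; cases b rule: oct_cases) simp

lemma inner_oconj_left: "oconj a \<bullet> b = a \<bullet> oconj b"
  by (cases a rule: oct_cases; cases b rule: oct_cases) simp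

lemma oconj_eq: "oconj a = (2 * (a \<bullet> oone)) *\<^sub>R oone - a"
  by (cases a rule: oct_cases) (simp add: oone_def)

section \<open>Adjoints, cancellation laws and Moufang identities\<close>

lemma omul_inner_left: "(a \<odot> b) \<bullet> c = b \<bullet> (oconj a \<odot> c)"
  by (cases a rule: oct_cases; cases b rule: oct_cases; cases c rule: oct_cases) (simp add: algebra_simps)

lemma omul_inner_right: "(a \<odot> b) \<bullet> c = a \<bullet> (c \<odot> oconj b)"
  by (cases a rule: oct_cases; cases b rule: oct_cases; cases c rule: oct_cases) (simp add: algebra_simps)

text \<open>A weak substitute for associativity. Together with the two adjointness rules it ends the
  computations in octonion coordinates; later identities are derived from these facts.\<close>

lemma oconj_omul_cancel [simp]: "oconj a \<odot> (a \<odot> b) = (a \<bullet> a) *\<^sub>R b"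
  by (cases a rule: oct_cases; cases b rule: oct_cases) (simp add: algebra_simps)

lemma omul_oconj_cancel [simp]: "a \<odot> (oconj a \<odot> b) = (a \<bullet> a) *\<^sub>R b"
  using oconj_omul_cancel [of "oconj a" b] by simp

lemma omul_cancel_right [simp]: "(b \<odot> a) \<odot> oconj a = (a \<bullet> a) *\<^sub>R b"
  using arg_cong [OF omul_oconj_cancel [of a "oconj b"], of oconj]
  by (simp del: omul_oconj_cancel oconj_omul_cancel)

lemma oconj_cancel_right [simp]: "(b \<odot> oconj a) \<odot> a = (a \<bullet> a) *\<^sub>R b"
  using omul_cancel_right [of b "oconj a"] by simp

lemma omul_oconj_self [simp]:
  "a \<odot> oconj a = (a \<bullet> a) *\<^sub>R oone" "oconj a \<odot> a = (a \<bullet> a) *\<^sub>R oone"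
  using omul_oconj_cancel [of a oone] oconj_omul_cancel [of a oone] by simp_all

lemma omul_inner_omul [simp]: "(a \<odot> b) \<bullet> (a \<odot> b) = (a \<bullet> a) * (b \<bullet> b)"
  by (simp add: omul_inner_left)

text \<open>Polarization of the cancellation law: apply it to \<open>p + q\<close> and subtract the
  cases \<open>p\<close> and \<open>q\<close>.\<close>

lemma oconj_omul_polarized:
  "oconj p \<odot> (q \<odot> x) + oconj q \<odot> (p \<odot> x) = (2 * (p \<bullet> q)) *\<^sub>R x"
  using oconj_omul_cancel [of "p + q" x]
  by (simp add: omul_distrib inner_commute [of q p] algebra_simps
      mult_2 flip: scaleR_scaleR)

text \<open>Polarization of \<open>omul_inner_omul\<close> in both factors. It exchanges right
  factors across an inner product, which replaces reassociation both in the Moufang identities and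
  in the computation of the metric.\<close>

lemma omul_inner_polarized:
  "(a \<odot> c) \<bullet> (b \<odot> d) + (a \<odot> d) \<bullet> (b \<odot> c) = 2 * (a \<bullet> b) * (c \<bullet> d)"
proof -
  have "(a \<odot> d) \<bullet> (b \<odot> c) = c \<bullet> (oconj b \<odot> (a \<odot> d))"
    by (metis inner_commute omul_inner_left)
  hence "(a \<odot> c) \<bullet> (b \<odot> d) + (a \<odot> d) \<bullet> (b \<odot> c) =
      c \<bullet> (oconj a \<odot> (b \<odot> d) + oconj b \<odot> (a \<odot> d))"
    by (simp add: omul_inner_left [of a c] inner_add_right)
  thus ?thesis
    by (simp add: oconj_omul_polarized)
qed

text \<open>The right-hand side depends on \<open>x \<odot> y\<close> only; this is what makes the Moufang identities work.\<close>

lemma Moufang_expand: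
  "(a \<odot> x) \<odot> (y \<odot> a) =
     (2 * ((x \<odot> y) \<bullet> oconj a)) *\<^sub>R a - (a \<bullet> a) *\<^sub>R oconj (x \<odot> y)"
proof -
  have "((a \<odot> x) \<odot> (y \<odot> a)) \<bullet> t =
    ((2 * ((x \<odot> y) \<bullet> oconj a)) *\<^sub>R a - (a \<bullet> a) *\<^sub>R oconj (x \<odot> y)) \<bullet> t" for t
  proof -
    have "((a \<odot> x) \<odot> (y \<odot> a)) \<bullet> t = (a \<odot> x) \<bullet> (t \<odot> (oconj a \<odot> oconj y))"
      by (simp add: omul_inner_right)
    \<comment> \<open>Exchanging the right factors brings \<open>a\<close> next to
      \<open>oconj a\<close>, where the two cancel.\<close>
    also have "\<dots> = 2 * (a \<bullet> t) * (x \<bullet> (oconj a \<odot> oconj y))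
        - (a \<odot> (oconj a \<odot> oconj y)) \<bullet> (t \<odot> x)"
      using omul_inner_polarized [of a x t "oconj a \<odot> oconj y"] by simp
    also have "x \<bullet> (oconj a \<odot> oconj y) = (x \<odot> y) \<bullet> oconj a"
      by (simp add: omul_inner_right)
    also have "(a \<odot> (oconj a \<odot> oconj y)) \<bullet> (t \<odot> x) = (a \<bullet> a) * (oconj (x \<odot> y) \<bullet> t)"
      using omul_inner_right [of t x "oconj y"] by (simp add: inner_commute)
    finally show ?thesis
      by (simp add: inner_diff_left)
  qed
  thus ?thesis
    by (rule vector_eq_rdot [THEN iffD1, OF allI])
qed

text \<open>The pairs \<open>(x, y)\<close> and \<open>(x \<odot> y, oone)\<close> have the same
  product, so \<open>Moufang_expand\<close> gives them the same value.\<close>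

lemma Moufang_middle: "(a \<odot> x) \<odot> (y \<odot> a) = (a \<odot> (x \<odot> y)) \<odot> a"
  using Moufang_expand [of a x y] Moufang_expand [of a "x \<odot> y" oone] by simp

text \<open>Expanding \<open>(a \<odot> x) \<odot> a\<close> leaves one term in which
  \<open>a\<close> cancels against \<open>oconj a\<close>, and the term
  \<open>oconj x \<odot> (oconj a \<odot> y)\<close>, which the polarized cancellation law
  rewrites.\<close>

lemma Moufang_left:
  "((a \<odot> x) \<odot> a) \<odot> (oconj a \<odot> y) = (a \<bullet> a) *\<^sub>R (a \<odot> (x \<odot> y))"
proof -
  have "(a \<odot> x) \<odot> a = (2 * (x \<bullet> oconj a)) *\<^sub>R a - (a \<bullet> a) *\<^sub>R oconj x"
    using Moufang_expand [of a x oone] by simp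
  hence "((a \<odot> x) \<odot> a) \<odot> (oconj a \<odot> y) =
      (a \<bullet> a) *\<^sub>R ((2 * (x \<bullet> oconj a)) *\<^sub>R y - oconj x \<odot> (oconj a \<odot> y))"
    by (simp add: omul_distrib scaleR_diff_right mult.commute)
  also have "(2 * (x \<bullet> oconj a)) *\<^sub>R y - oconj x \<odot> (oconj a \<odot> y) = a \<odot> (x \<odot> y)"
    using oconj_omul_polarized [of x "oconj a" y] by (simp add: algebra_simps)
  finally show ?thesis .
qed

text \<open>Trades a factor for its conjugate, so that \<open>y \<odot> x\<close> can be computed
  from a matrix relation that only gives \<open>y \<odot> oconj x\<close>.\<close>

lemma omul_as_oconj: "a \<odot> b = (2 * (a \<bullet> oone)) *\<^sub>R b - oconj a \<odot> b"
  "a \<odot> b = (2 * (b \<bullet> oone)) *\<^sub>R a - a \<odot> oconj b"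
  by (simp_all add: oconj_eq omul_distrib)

lemma inner_oconj_commute: "a \<bullet> oconj b = b \<bullet> oconj a"
  by (metis inner_commute inner_oconj_left)

lemma inner_add_oone:
  "(a + k *\<^sub>R oone) \<bullet> (a + k *\<^sub>R oone) = a \<bullet> a + 2 * k * (a \<bullet> oone) + k\<^sup>2"
  by (simp add: inner_add_left inner_add_right inner_commute [of oone a] power2_eq_square
      algebra_simps)

text \<open>The normalized conjugate of \<open>y\<close> works. This is how the triality maps make a
  matrix entry real and nonnegative.\<close>

lemma unit_multiple_exists:
  obtains a where "a \<bullet> a = 1" "a \<odot> y = norm y *\<^sub>R oone"
proof (cases "y = 0")
  case True
  thus ?thesis using that [of oone] by simp
next
  case False
  hence "inverse (norm y) *\<^sub>R oconj y \<odot> y = norm y *\<^sub>R oone"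
    by (simp add: dot_square_norm power2_eq_square)
  moreover have "(inverse (norm y) *\<^sub>R oconj y) \<bullet> (inverse (norm y) *\<^sub>R oconj y) =
      (inverse (norm y))\<^sup>2 * (y \<bullet> y)"
    by (simp add: power2_eq_square)
  hence "(inverse (norm y) *\<^sub>R oconj y) \<bullet> (inverse (norm y) *\<^sub>R oconj y) = 1"
    using False by (simp add: dot_square_norm power_inverse)
  ultimately show ?thesis using that by blast
qed

section \<open>Rational maps\<close>

text \<open>A class of functions without poles on \<open>S\<close> that is closed under directional
  derivatives, so that smoothness follows by iteration.\<close>

inductive rational_fun :: "'a::real_normed_vector set \<Rightarrow> ('a \<Rightarrow> real) \<Rightarrow> bool" for S where
  const: "rational_fun S (\<lambda>x. c)"
| linear: "bounded_linear l \<Longrightarrow> rational_fun S l"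
| add: "rational_fun S f \<Longrightarrow> rational_fun S g \<Longrightarrow> rational_fun S (\<lambda>x. f x + g x)"
| mult: "rational_fun S f \<Longrightarrow> rational_fun S g \<Longrightarrow> rational_fun S (\<lambda>x. f x * g x)"
| inverse: "rational_fun S f \<Longrightarrow> (\<And>x. x \<in> S \<Longrightarrow> f x \<noteq> 0) \<Longrightarrow> rational_fun S (\<lambda>x. inverse (f x))"

lemma rational_fun_sum:
  "(\<And>i. i \<in> I \<Longrightarrow> rational_fun S (f i)) \<Longrightarrow> rational_fun S (\<lambda>x. \<Sum>i\<in>I. f i x)"
  by (induction I rule: infinite_finite_induct) (auto intro: rational_fun.intros)

lemma rational_fun_has_derivative:
  assumes "rational_fun S f"
  shows "\<exists>D. (\<forall>x\<in>S. (f has_derivative D x) (at x)) \<and> (\<forall>v. rational_fun S (\<lambda>x. D x v))"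
  using assms
proof induction
  case (const c)
  show ?case
    by (rule exI [where x = "\<lambda>_ _. 0"]) (auto intro: rational_fun.const)
next
  case (linear l)
  thus ?case
    by (intro exI [where x = "\<lambda>_. l"])
      (auto intro: rational_fun.const bounded_linear_imp_has_derivative)
next
  case (add f g)
  then obtain D E where
    "\<forall>x\<in>S. (f has_derivative D x) (at x)" "\<forall>v. rational_fun S (\<lambda>x. D x v)"
    "\<forall>x\<in>S. (g has_derivative E x) (at x)" "\<forall>v. rational_fun S (\<lambda>x. E x v)"
    by auto
  thus ?case
    by (intro exI [where x = "\<lambda>x v. D x v + E x v"])
      (auto intro: rational_fun.intros has_derivative_add)
next
  case (mult f g)
  then obtain D E where
    "\<forall>x\<in>S. (f has_derivative D x) (at x)" "\<forall>v. rational_fun S (\<lambda>x. D x v)"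
    "\<forall>x\<in>S. (g has_derivative E x) (at x)" "\<forall>v. rational_fun S (\<lambda>x. E x v)"
    by auto
  with mult.hyps show ?case
    by (intro exI [where x = "\<lambda>x v. f x * E x v + D x v * g x"])
      (auto intro!: rational_fun.add rational_fun.mult has_derivative_mult)
next
  case (inverse f)
  then obtain D where D:
    "\<forall>x\<in>S. (f has_derivative D x) (at x)" "\<forall>v. rational_fun S (\<lambda>x. D x v)"
    by auto
  \<comment> \<open>Negation is not among the generators, so the sign is written as a constant
    factor.\<close>
  have "rational_fun S (\<lambda>x. (- 1) * (inverse (f x) * D x v * inverse (f x)))" for v
    using D(2) rational_fun.inverse [OF inverse.hyps]
    by (intro rational_fun.mult rational_fun.const) auto
  thus ?case
    using D(1) inverse.hyps(2)
    by (intro exI [where x = "\<lambda>x v. - (inverse (f x) * D x v * inverse (f x))"]) auto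
qed

definition rational_map :: "'a::real_normed_vector set \<Rightarrow> ('a \<Rightarrow> 'b::euclidean_space) \<Rightarrow> bool" where
  "rational_map S f \<longleftrightarrow> (\<forall>b\<in>Basis. rational_fun S (\<lambda>x. f x \<bullet> b))"

lemma rational_map_real: "rational_map S f \<longleftrightarrow> rational_fun S f" for f :: "_ \<Rightarrow> real"
  by (simp add: rational_map_def)

lemma rational_map_const: "rational_map S (\<lambda>x. c)"
  by (simp add: rational_map_def rational_fun.const)

lemma rational_map_linear:
  fixes l :: "'b::euclidean_space \<Rightarrow> 'c::euclidean_space"
  assumes l: "bounded_linear l" and f: "rational_map S f"
  shows "rational_map S (\<lambda>x. l (f x))"
  unfolding rational_map_def
proof
  fix b :: 'c assume "b \<in> Basis"
  interpret bounded_linear l by fact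
  have "l (f x) \<bullet> b = (\<Sum>i\<in>Basis. (f x \<bullet> i) * (l i \<bullet> b))" for x
  proof -
    have "l (f x) = l (\<Sum>i\<in>Basis. (f x \<bullet> i) *\<^sub>R i)"
      by (simp add: euclidean_representation)
    thus ?thesis by (simp add: sum scaleR inner_sum_left)
  qed
  thus "rational_fun S (\<lambda>x. l (f x) \<bullet> b)"
    using f by (auto simp: rational_map_def intro!: rational_fun_sum intro: rational_fun.intros)
qed

lemma rational_map_id: "rational_map S (\<lambda>x. x)"
  by (auto simp: rational_map_def intro!: rational_fun.linear bounded_linear_intros)

lemma rational_map_Pair:
  "rational_map S f \<Longrightarrow> rational_map S g \<Longrightarrow> rational_map S (\<lambda>x. (f x, g x))"
  by (auto simp: rational_map_def Basis_prod_def)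

lemma rational_map_bilinear:
  fixes h :: "'b::euclidean_space \<Rightarrow> 'c::euclidean_space \<Rightarrow> 'd::euclidean_space"
  assumes h: "bounded_bilinear h" and f: "rational_map S f" and g: "rational_map S g"
  shows "rational_map S (\<lambda>x. h (f x) (g x))"
  unfolding rational_map_def
proof
  fix b :: 'd assume "b \<in> Basis"
  interpret bounded_bilinear h by fact
  have "h (f x) (g x) \<bullet> b =
      (\<Sum>j\<in>Basis. \<Sum>i\<in>Basis. (g x \<bullet> j) * ((f x \<bullet> i) * (h i j \<bullet> b)))" for x
  proof -
    have "h (f x) (g x) = h (\<Sum>i\<in>Basis. (f x \<bullet> i) *\<^sub>R i) (\<Sum>j\<in>Basis. (g x \<bullet> j) *\<^sub>R j)"
      by (simp add: euclidean_representation)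
    thus ?thesis
      by (simp add: sum_left sum_right scaleR_left scaleR_right inner_sum_left mult.assoc
          sum_distrib_left)
  qed
  thus "rational_fun S (\<lambda>x. h (f x) (g x) \<bullet> b)"
    using f g by (auto simp: rational_map_def
        intro!: rational_fun_sum rational_fun.mult rational_fun.const)
qed

lemmas rational_map_intros =
  rational_map_const rational_map_id rational_map_Pair
  rational_map_bilinear [OF bounded_bilinear_omul]
  rational_map_bilinear [OF bounded_bilinear_inner]
  rational_map_bilinear [OF bounded_bilinear_scaleR]
  rational_map_linear [OF bounded_linear_oconj]
  rational_map_linear [OF bounded_linear_fst]
  rational_map_linear [OF bounded_linear_snd]

lemma rational_map_add:
  "rational_map S f \<Longrightarrow> rational_map S g \<Longrightarrow> rational_map S (\<lambda>x. f x + g x)"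
  by (auto simp: rational_map_def inner_add_left intro: rational_fun.intros)

lemma rational_map_diff:
  "rational_map S f \<Longrightarrow> rational_map S g \<Longrightarrow> rational_map S (\<lambda>x. f x - g x)"
  using rational_map_add [of S f "\<lambda>x. - g x"]
    rational_map_linear [OF bounded_linear_minus [OF bounded_linear_ident], of S g] by simp

lemma rational_map_inverse:
  fixes f :: "_ \<Rightarrow> real"
  shows "rational_map S f \<Longrightarrow> (\<And>x. x \<in> S \<Longrightarrow> f x \<noteq> 0) \<Longrightarrow> rational_map S (\<lambda>x. inverse (f x))"
  by (simp add: rational_map_real rational_fun.inverse)

lemma rational_map_has_derivative:
  assumes "rational_map S f"
  shows "\<exists>D. (\<forall>x\<in>S. (f has_derivative D x) (at x)) \<and> (\<forall>v. rational_map S (\<lambda>x. D x v))"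
proof -
  have "\<forall>b\<in>Basis. \<exists>D. (\<forall>x\<in>S. ((\<lambda>x. f x \<bullet> b) has_derivative D x) (at x)) \<and>
      (\<forall>v. rational_fun S (\<lambda>x. D x v))"
    using assms by (auto simp: rational_map_def intro: rational_fun_has_derivative)
  then obtain D where D:
    "\<And>b x. b \<in> Basis \<Longrightarrow> x \<in> S \<Longrightarrow> ((\<lambda>x. f x \<bullet> b) has_derivative D b x) (at x)"
    "\<And>b v. b \<in> Basis \<Longrightarrow> rational_fun S (\<lambda>x. D b x v)"
    by metis
  show ?thesis
  proof (intro exI conjI allI ballI)
    fix x assume "x \<in> S"
    thus "(f has_derivative (\<lambda>v. \<Sum>b\<in>Basis. D b x v *\<^sub>R b)) (at x)"
      using D(1) by (subst has_derivative_componentwise_within) auto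
  next
    fix v show "rational_map S (\<lambda>x. \<Sum>b\<in>Basis. D b x v *\<^sub>R b)"
      using D(2) by (auto simp: rational_map_def)
  qed
qed

lemma rational_map_mono:
  assumes "rational_map S f" "T \<subseteq> S"
  shows "rational_map T f"
proof -
  have "rational_fun T g" if "rational_fun S g" for g
    using that by induction (use assms(2) in \<open>auto intro: rational_fun.intros\<close>)
  thus ?thesis using assms(1) by (simp add: rational_map_def)
qed

lemma rational_map_continuous: "rational_map S f \<Longrightarrow> continuous_on S f"
  using rational_map_has_derivative has_derivative_continuous continuous_at_imp_continuous_on
  by metis

lemma Cinf_on_rational_map:
  assumes S: "open S" and f: "rational_map S f" and eq: "\<And>x. x \<in> S \<Longrightarrow> f' x = f x"
  shows "Cinf_on S f'"
proof -
  \<comment> \<open>As \<open>S\<close> is open, derivatives at its points ignore the values outside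
    \<open>S\<close>.\<close>
  have transfer: "(g has_derivative D) (at x) \<longleftrightarrow> (h has_derivative D) (at x)"
    if "\<And>x. x \<in> S \<Longrightarrow> g x = h x" "x \<in> S" for g h :: "'a \<Rightarrow> 'b" and D x
    using has_derivative_transform_within_open [OF _ S that(2)] that(1) by metis
  \<comment> \<open>\<open>iter_deriv\<close> leaves the derivatives arbitrary outside
    \<open>S\<close>, so the invariant only asks for agreement with a rational map on
    \<open>S\<close>.\<close>
  have "\<exists>h. rational_map S h \<and> (\<forall>x\<in>S. g x = h x)" if "iter_deriv S f' g" for g
    using that
  proof induction
    case base
    show ?case using f eq by blast
  next
    case (step g D v)
    then obtain h where h: "rational_map S h" "\<And>x. x \<in> S \<Longrightarrow> g x = h x"
      by blast
    obtain E where E: "\<And>x. x \<in> S \<Longrightarrow> (h has_derivative E x) (at x)"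
      "rational_map S (\<lambda>x. E x v)"
      using rational_map_has_derivative [OF h(1)] by blast
    have "D x = E x" if "x \<in> S" for x
      using has_derivative_unique step.hyps(2) [OF that] E(1) [OF that]
        transfer [of g h x] h(2) that by blast
    thus ?case using E(2) by auto
  qed
  thus ?thesis
    unfolding Cinf_on_def differentiable_def
    using S rational_map_has_derivative transfer by metis
qed

section \<open>The plane as a set of Hermitian matrices\<close>

text \<open>Keeps quantified octonions and matrices whole instead of splitting them into
  coordinates.\<close>

declare split_paired_All [simp del] split_paired_Ex [simp del]

type_synonym herm = "real \<times> real \<times> real \<times> oct \<times> oct \<times> oct"

fun outer :: "triple \<Rightarrow> herm" where
  "outer (a, b, c) = (a \<bullet> a, b \<bullet> b, c \<bullet> c, b \<odot> oconj a, c \<odot> oconj a, c \<odot> oconj b)"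

fun weight :: "triple \<Rightarrow> real" where
  "weight (a, b, c) = a \<bullet> a + b \<bullet> b - c \<bullet> c"

definition proj :: "triple \<Rightarrow> herm" where
  "proj t = inverse (weight t) *\<^sub>R outer t"

text \<open>A tuple \<open>(\<alpha>, \<beta>, \<gamma>, x, y, z)\<close> lists the diagonal of a Hermitian matrix followed by its
  \<open>(2,1)\<close>, \<open>(3,1)\<close> and \<open>(3,2)\<close> entries. The six products in the next definition say that
  Freudenthal's adjoint vanishes, i.e. that the matrix has rank one; \<open>0 \<le> \<gamma>\<close> excludes
  \<open>[0, 0, 1]\<close> and all other points with \<open>|a|\<^sup>2 + |b|\<^sup>2 < |c|\<^sup>2\<close>.\<close>

definition projections :: "herm set" where
  "projections = {(\<alpha>, \<beta>, \<gamma>, x, y, z). \<alpha> + \<beta> - \<gamma> = 1 \<and> 0 \<le> \<gamma> \<and>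
     x \<bullet> x = \<alpha> * \<beta> \<and> y \<bullet> y = \<alpha> * \<gamma> \<and> z \<bullet> z = \<beta> * \<gamma> \<and>
     z \<odot> x = \<beta> *\<^sub>R y \<and> y \<odot> oconj x = \<alpha> *\<^sub>R z \<and> oconj z \<odot> y = \<gamma> *\<^sub>R x}"

text \<open>Half the trace of the square of \<open>X J\<close>, where \<open>X\<close> is the
  Hermitian matrix and \<open>J = diag(1, 1, -1)\<close>. Its pullback along the embedding is the
  metric.\<close>

fun trace_form :: "herm \<Rightarrow> real" where
  "trace_form (\<alpha>, \<beta>, \<gamma>, x, y, z) = (\<alpha>\<^sup>2 + \<beta>\<^sup>2 + \<gamma>\<^sup>2) / 2 + x \<bullet> x - y \<bullet> y - z \<bullet> z"

text \<open>Conjugation by the exchange of the first two coordinates. It turns the second chart into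
  the first, so that one embedding formula serves both.\<close>

fun swap12 :: "herm \<Rightarrow> herm" where
  "swap12 (\<alpha>, \<beta>, \<gamma>, x, y, z) = (\<beta>, \<alpha>, \<gamma>, oconj x, z, y)"

lemma swap12_swap12 [simp]: "swap12 (swap12 P) = P"
  by (cases P rule: swap12.cases) simp

lemma linear_swap12: "linear swap12"
  by (rule linearI) auto

lemma trace_form_swap12 [simp]: "trace_form (swap12 P) = trace_form P"
  by (cases P rule: swap12.cases) simp

lemma swap12_in_projections [simp]: "swap12 P \<in> projections \<longleftrightarrow> P \<in> projections"
proof -
  have "swap12 P \<in> projections" if "P \<in> projections" for P
  proof (cases P rule: swap12.cases)
    case (1 \<alpha> \<beta> \<gamma> x y z)
    have "oconj z \<odot> y = \<gamma> *\<^sub>R x"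
      using that 1 by (simp add: projections_def)
    from arg_cong [OF this, of oconj] have "oconj y \<odot> z = \<gamma> *\<^sub>R oconj x"
      by simp
    with that 1 show ?thesis
      by (auto simp: projections_def algebra_simps)
  qed
  from this [of P] this [of "swap12 P"] show ?thesis by auto
qed

definition lift :: "nat \<Rightarrow> oct \<times> oct \<Rightarrow> triple" where
  "lift i w = (if i = 1 then (oone, fst w, snd w) else (fst w, oone, snd w))"

definition flip :: "nat \<Rightarrow> herm \<Rightarrow> herm" where
  "flip i P = (if i = 1 then P else swap12 P)"

lemma flip_flip [simp]: "flip i (flip i P) = P"
  by (simp add: flip_def)

lemma bounded_linear_flip: "bounded_linear (flip i)"
  using linear_swap12
  by (cases "i = 1") (simp_all add: flip_def [abs_def] linear_conv_bounded_linear)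

lemma trace_form_flip [simp]: "trace_form (flip i P) = trace_form P"
  by (simp add: flip_def)

lemma flip_in_projections [simp]: "flip i P \<in> projections \<longleftrightarrow> P \<in> projections"
  by (simp add: flip_def)

definition chart_embed :: "oct \<times> oct \<Rightarrow> herm" where
  "chart_embed w = proj (lift 1 w)"

text \<open>The first column of the matrix divided by its top entry is \<open>(1, u, v)\<close>, so
  this inverts \<open>chart_embed\<close> where that entry is nonzero.\<close>

definition unembed :: "herm \<Rightarrow> oct \<times> oct" where
  "unembed = (\<lambda>(\<alpha>, \<beta>, \<gamma>, x, y, z). (inverse \<alpha> *\<^sub>R x, inverse \<alpha> *\<^sub>R y))"

lemma chart_dom_eq: "chart_dom i = {(u, v). 1 + u \<bullet> u - v \<bullet> v > 0}"
  by (auto simp: chart_dom_def onorm2_eq_inner)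

lemma proj_lift: "proj (lift i w) = flip i (chart_embed w)"
  by (cases w rule: prod.exhaust) (simp add: chart_embed_def proj_def lift_def flip_def add.commute)

lemma embed_eq:
  "chart_embed (u, v) = inverse (1 + u \<bullet> u - v \<bullet> v) *\<^sub>R (1, u \<bullet> u, v \<bullet> v, u, v, v \<odot> oconj u)"
  by (simp add: chart_embed_def proj_def lift_def)

lemma embed_in_projections:
  assumes "w \<in> chart_dom i"
  shows "chart_embed w \<in> projections"
proof -
  obtain u v where Pair: "w = (u, v)" by (rule prod.exhaust)
  define N where "N = 1 + u \<bullet> u - v \<bullet> v"
  have N: "N > 0" using assms by (simp add: chart_dom_eq Pair N_def)
  have "inverse N + inverse N * (u \<bullet> u) - inverse N * (v \<bullet> v) = inverse N * (1 + u \<bullet> u - v \<bullet> v)"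
    by (simp add: algebra_simps)
  also have "\<dots> = 1"
    using N by (simp flip: N_def)
  finally show ?thesis
    unfolding Pair embed_eq N_def [symmetric] using N
    by (simp add: projections_def mult.commute mult.left_commute)
qed

lemma unembed_embed:
  assumes "w \<in> chart_dom i"
  shows "fst (chart_embed w) > 0" "unembed (chart_embed w) = w"
  using assms by (cases w rule: prod.exhaust; simp add: embed_eq unembed_def chart_dom_eq)+

lemma embed_unembed:
  assumes "P \<in> projections" "fst P \<noteq> 0"
  shows "unembed P \<in> chart_dom i" "chart_embed (unembed P) = P"
proof -
  obtain \<alpha> \<beta> \<gamma> x y z where P: "P = (\<alpha>, \<beta>, \<gamma>, x, y, z)"
    by (cases P rule: swap12.cases)
  have eqs: "\<alpha> + \<beta> - \<gamma> = 1" "0 \<le> \<gamma>" "x \<bullet> x = \<alpha> * \<beta>" "y \<bullet> y = \<alpha> * \<gamma>" "y \<odot> oconj x = \<alpha> *\<^sub>R z"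
    and "\<alpha> \<noteq> 0"
    using assms by (auto simp: projections_def P)
  have "\<alpha> * \<gamma> \<ge> 0" by (metis eqs(4) inner_ge_zero)
  moreover have "\<alpha> * \<beta> \<ge> 0" by (metis eqs(3) inner_ge_zero)
  \<comment> \<open>A negative \<alpha> would force \<beta> \<le> 0, and then \<alpha> + \<beta> -
    \<gamma> could not be 1.\<close>
  ultimately have "\<alpha> > 0"
    using \<open>\<alpha> \<noteq> 0\<close> eqs(1,2) by (smt (verit) mult_neg_pos zero_less_mult_iff)
  have N: "1 + inverse \<alpha> *\<^sub>R x \<bullet> inverse \<alpha> *\<^sub>R x - inverse \<alpha> *\<^sub>R y \<bullet> inverse \<alpha> *\<^sub>R y = inverse \<alpha>"
    using eqs \<open>\<alpha> > 0\<close> by (simp add: field_simps)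
  show "unembed P \<in> chart_dom i"
    unfolding unembed_def P prod.case chart_dom_eq mem_Collect_eq N using \<open>\<alpha> > 0\<close> by simp
  show "chart_embed (unembed P) = P"
    using \<open>\<alpha> > 0\<close> unfolding unembed_def P prod.case embed_eq N
    by (simp add: eqs)
qed

lemma omul_eq_iff_right:
  assumes "c \<noteq> 0"
  shows "a \<odot> c = b \<longleftrightarrow> a = inverse (c \<bullet> c) *\<^sub>R (b \<odot> oconj c)"
proof
  assume "a = inverse (c \<bullet> c) *\<^sub>R (b \<odot> oconj c)"
  thus "a \<odot> c = b" using assms by simp
qed (use assms in auto)

text \<open>The transition between the two charts. The coordinate equal to one forces
  \<open>l = u\<close>, and right cancellation then determines \<open>u'\<close> and
  \<open>v'\<close> without associativity.\<close>

lemma omul_right_transition: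
  "(\<exists>l. l \<noteq> 0 \<and> oone = u' \<odot> l \<and> u = l \<and> v = v' \<odot> l) \<longleftrightarrow>
   u \<noteq> 0 \<and> (u', v') = (inverse (u \<bullet> u) *\<^sub>R oconj u, inverse (u \<bullet> u) *\<^sub>R (v \<odot> oconj u))"
  using omul_eq_iff_right [of u u' oone] omul_eq_iff_right [of u v' v] by auto

lemma lift_in_U: "w \<in> chart_dom i \<Longrightarrow> lift i w \<in> U1 \<union> U2"
  by (cases w rule: prod.exhaust) (auto simp: U1_def U2_def lift_def chart_dom_def split: if_splits)

text \<open>Replaces the scaling relation, whose transitivity is not evident without associativity,
  by equality of matrices. Within one chart both sides mean \<open>w = w'\<close>; across charts
  both reduce to the transition formula.\<close>

lemma oprel_lift_iff:
  assumes w: "w \<in> chart_dom i" and w': "w' \<in> chart_dom j"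
  shows "(lift i w, lift j w') \<in> oprel \<longleftrightarrow> proj (lift i w) = proj (lift j w')"
proof -
  obtain u v u' v' where uv: "w = (u, v)" "w' = (u', v')" by (metis surj_pair)
  \<comment> \<open>The matrix of \<open>w\<close>, rearranged for chart \<open>j\<close>; it is in
    the range of that chart exactly when its top entry is nonzero.\<close>
  define P where "P = flip j (flip i (chart_embed w))"
  have P: "P \<in> projections"
    using embed_in_projections [OF w] by (simp add: P_def)
  have "proj (lift i w) = proj (lift j w') \<longleftrightarrow> chart_embed w' = P"
    by (auto simp: P_def proj_lift)
  also have "\<dots> \<longleftrightarrow> fst P \<noteq> 0 \<and> unembed P = w'"
    using unembed_embed [OF w'] embed_unembed [OF P] by auto
  also have "\<dots> \<longleftrightarrow> (\<exists>l. l \<noteq> 0 \<and> lift i w =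
      (fst (lift j w') \<odot> l, fst (snd (lift j w')) \<odot> l, snd (snd (lift j w')) \<odot> l))"
  proof (cases "i = 1 \<longleftrightarrow> j = 1")
    case True
    hence "P = chart_embed w" by (auto simp: P_def flip_def)
    hence "fst P \<noteq> 0 \<and> unembed P = w' \<longleftrightarrow> w = w'"
      using unembed_embed [OF w] by auto
    thus ?thesis using True by (cases "i = 1") (auto simp: lift_def uv)
  next
    case False
    hence "P = swap12 (chart_embed w)" by (auto simp: P_def flip_def)
    moreover have "1 + u \<bullet> u - v \<bullet> v > 0" using w by (simp add: chart_dom_eq uv)
    ultimately have "fst P \<noteq> 0 \<and> unembed P = w' \<longleftrightarrow> u \<noteq> 0 \<and> 
      (u', v') = (inverse (u \<bullet> u) *\<^sub>R oconj u, inverse (u \<bullet> u) *\<^sub>R (v \<odot> oconj u))"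
      by (auto simp: uv embed_eq unembed_def)
    thus ?thesis
      using False unfolding omul_right_transition [symmetric]
      by (auto simp: lift_def uv)
  qed
  finally have "proj (lift i w) = proj (lift j w') \<longleftrightarrow> (\<exists>l. l \<noteq> 0 \<and> lift i w =
      (fst (lift j w') \<odot> l, fst (snd (lift j w')) \<odot> l, snd (snd (lift j w')) \<odot> l))" .
  moreover have "lift i w \<in> U1 \<union> U2" "lift j w' \<in> U1 \<union> U2"
    using w w' by (auto intro!: lift_in_U simp del: Un_iff)
  ultimately show ?thesis
    by (simp add: oprel_def)
qed

section \<open>Identification of the plane with the set of rank one matrices\<close>

definition point :: "herm \<Rightarrow> triple set" where
  "point P = {t \<in> U1 \<union> U2. proj t = P}"

lemma U_cases:
  assumes "t \<in> U1 \<union> U2"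
  obtains i w where "t = lift i w" "w \<in> chart_dom i"
proof -
  consider u v where "t = lift 1 (u, v)" "1 + onorm2 u - onorm2 v > 0"
    | u v where "t = lift 2 (u, v)" "onorm2 u + 1 - onorm2 v > 0"
    using assms by (auto simp: U1_def U2_def lift_def)
  thus ?thesis using that by cases (auto simp: chart_dom_def)
qed

lemma oprel_iff: "(p, q) \<in> oprel \<longleftrightarrow> p \<in> U1 \<union> U2 \<and> q \<in> U1 \<union> U2 \<and> proj p = proj q"
proof (cases "p \<in> U1 \<union> U2 \<and> q \<in> U1 \<union> U2")
  case True
  thus ?thesis using oprel_lift_iff by (metis U_cases)
next
  case False
  thus ?thesis by (simp add: oprel_def) blast
qed

lemma chart_inv_eq:
  assumes "w \<in> chart_dom i"
  shows "chart_inv i w = point (flip i (chart_embed w))"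
proof -
  have "chart_inv i w = {t. (lift i w, t) \<in> oprel}"
    by (simp add: chart_inv_def lift_def Image_singleton)
  also have "\<dots> = point (flip i (chart_embed w))"
    using lift_in_U [OF assms] by (auto simp: oprel_iff point_def proj_lift)
  finally show ?thesis .
qed

text \<open>The two charts cover everything because \<alpha> + \<beta> = 1 + \<gamma> is
  positive.\<close>

lemma projections_cases:
  assumes "P \<in> projections"
  obtains i where "i \<in> {1, 2}" "fst (flip i P) \<noteq> 0"
proof -
  have "fst P \<noteq> 0 \<or> fst (swap12 P) \<noteq> 0"
    using assms by (auto simp: projections_def)
  thus ?thesis
    using that [of 1] that [of 2] by (auto simp: flip_def)
qed

lemma point_nonempty:
  assumes "P \<in> projections"
  shows "\<exists>t. t \<in> point P"
proof -
  obtain i where i: "fst (flip i P) \<noteq> 0" using projections_cases assms by blast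
  with assms have "lift i (unembed (flip i P)) \<in> point P"
    using lift_in_U [of "unembed (flip i P)" i]
    by (simp add: point_def proj_lift embed_unembed)
  thus ?thesis ..
qed

lemma inj_on_point: "inj_on point projections"
  proof (rule inj_onI)
  fix P Q assume "P \<in> projections" "point P = point Q"
  then obtain t where "t \<in> point P" "t \<in> point Q" using point_nonempty by blast
  thus "P = Q" by (simp add: point_def)
qed

lemma OP11_eq: "OP11 = point ` projections"
proof -
  have *: "oprel `` {t} = point (proj t)" if "t \<in> U1 \<union> U2" for t
    using that by (auto simp: point_def oprel_iff)
  have "proj ` (U1 \<union> U2) = projections"
  proof (intro set_eqI iffI)
    fix P assume "P \<in> proj ` (U1 \<union> U2)"
    then obtain t where "t \<in> U1 \<union> U2" "P = proj t" by blast
    thus "P \<in> projections"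
      by (metis U_cases proj_lift embed_in_projections flip_in_projections)
  next
    fix P assume "P \<in> projections"
    thus "P \<in> proj ` (U1 \<union> U2)"
      using point_nonempty [of P] unfolding point_def by blast
  qed
  moreover have "OP11 = (\<lambda>t. point (proj t)) ` (U1 \<union> U2)"
    unfolding OP11_def quotient_def using * by blast
  ultimately show ?thesis by (metis image_image)
qed

lemma point_in_chart_iff:
  assumes "P \<in> projections"
  shows "point P \<in> chart_inv j ` chart_dom j \<longleftrightarrow> fst (flip j P) \<noteq> 0"
proof
  assume "point P \<in> chart_inv j ` chart_dom j"
  then obtain w where w: "w \<in> chart_dom j" "point P = point (flip j (chart_embed w))"
    by (auto simp: chart_inv_eq)
  hence "P = flip j (chart_embed w)"
    using inj_onD [OF inj_on_point] assms embed_in_projections by auto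
  thus "fst (flip j P) \<noteq> 0"
    using unembed_embed [OF w(1)] by simp
next
  assume "fst (flip j P) \<noteq> 0"
  hence "unembed (flip j P) \<in> chart_dom j" "chart_embed (unembed (flip j P)) = flip j P"
    using embed_unembed assms by auto
  thus "point P \<in> chart_inv j ` chart_dom j"
    by (metis chart_inv_eq flip_flip imageI)
qed

lemma chart_point:
  assumes "P \<in> projections" "fst (flip j P) \<noteq> 0"
  shows "chart j (point P) = unembed (flip j P)"
  unfolding chart_def
proof (rule the_equality)
  show "unembed (flip j P) \<in> chart_dom j \<and> chart_inv j (unembed (flip j P)) = point P"
    using embed_unembed [of "flip j P"] assms by (simp add: chart_inv_eq)
next
  fix w assume w: "w \<in> chart_dom j \<and> chart_inv j w = point P"
  hence "point (flip j (chart_embed w)) = point P"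
    using chart_inv_eq [of w j] by simp
  hence "flip j (chart_embed w) = P"
    using inj_onD [OF inj_on_point, of "flip j (chart_embed w)" P] assms w
      embed_in_projections [of w j] by simp
  thus "w = unembed (flip j P)"
    using unembed_embed(2) [of w j] w by auto
qed

section \<open>Isometries induced by linear maps\<close>

text \<open>The metric is the pullback of \<open>trace_form\<close>: the quotient rule gives the
  derivative, and what remains is a polynomial identity in inner products.\<close>

lemma chart_embed_has_derivative:
  assumes "w \<in> chart_dom i"
  shows "\<exists>D. (chart_embed has_derivative D) (at w) \<and> (\<forall>t. trace_form (D t) = gform w t)"
proof -
  obtain u v where w: "w = (u, v)" by (rule prod.exhaust)
  define N where "N = 1 + u \<bullet> u - v \<bullet> v"
  have N: "N > 0" using assms by (simp add: chart_dom_eq w N_def)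
  define M :: "oct \<times> oct \<Rightarrow> herm" where
    "M = (\<lambda>w. (1, fst w \<bullet> fst w, snd w \<bullet> snd w, fst w, snd w, snd w \<odot> oconj (fst w)))"
  define dM :: "oct \<times> oct \<Rightarrow> herm" where
    "dM = (\<lambda>t. (0, 2 * (u \<bullet> fst t), 2 * (v \<bullet> snd t), fst t, snd t,
       v \<odot> oconj (fst t) + snd t \<odot> oconj u))"
  define dN where "dN = (\<lambda>t :: oct \<times> oct. 2 * (u \<bullet> fst t) - 2 * (v \<bullet> snd t))"
  have dM: "(M has_derivative dM) (at w)"
    unfolding M_def dM_def
    by (auto intro!: derivative_eq_intros bounded_linear.has_derivative [OF bounded_linear_oconj]
        bounded_bilinear.FDERIV [OF bounded_bilinear_omul] simp: w inner_commute)
  have dN: "((\<lambda>w. 1 + fst w \<bullet> fst w - snd w \<bullet> snd w) has_derivative dN) (at w)"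
    unfolding dN_def by (auto intro!: derivative_eq_intros simp: w inner_commute)
  define D where "D = (\<lambda>t. inverse N *\<^sub>R dM t - (inverse N * dN t * inverse N) *\<^sub>R M w)"
  have "((\<lambda>w. inverse (1 + fst w \<bullet> fst w - snd w \<bullet> snd w)) has_derivative
      (\<lambda>t. - (inverse N * dN t * inverse N))) (at w)"
    using Deriv.has_derivative_inverse [OF _ dN] N by (simp add: w N_def)
  from has_derivative_scaleR [OF this dM]
  have "((\<lambda>w. inverse (1 + fst w \<bullet> fst w - snd w \<bullet> snd w) *\<^sub>R M w) has_derivative D) (at w)"
    by (simp add: D_def w N_def)
  moreover have "(\<lambda>w. inverse (1 + fst w \<bullet> fst w - snd w \<bullet> snd w) *\<^sub>R M w) = chart_embed"
    by (rule ext) (metis M_def embed_eq prod.collapse)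
  ultimately have "(chart_embed has_derivative D) (at w)" by simp
  moreover have "trace_form (D t) = gform w t" for t
  proof -
    obtain \<xi> \<eta> where t: "t = (\<xi>, \<eta>)" by (rule prod.exhaust)
    \<comment> \<open>Here \<open>e\<close> is the logarithmic derivative of \<open>N\<close> along
      \<open>t\<close>, \<open>\<zeta>\<close> is the derivative of
      \<open>v \<odot> oconj u\<close>, and \<open>K\<close> is the octonionic term of the
      metric.\<close>
    define p q U V X Y K e \<zeta> where defs: "p = u \<bullet> \<xi>" "q = v \<bullet> \<eta>" "U = u \<bullet> u" "V = v \<bullet> v" 
      "X = \<xi> \<bullet> \<xi>" "Y = \<eta> \<bullet> \<eta>" "K = (\<eta> \<odot> oconj \<xi>) \<bullet> (v \<odot> oconj u)" "e = inverse N * (2 * p - 2 * q)"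
      "\<zeta> = v \<odot> oconj \<xi> + \<eta> \<odot> oconj u"
    have eN: "e * N = 2 * p - 2 * q" and NUV: "N = 1 + U - V"
      using N by (simp_all add: defs N_def)
    \<comment> \<open>The mixed product in \<open>\<zeta> \<bullet> \<zeta>\<close> has its factors
      paired differently from \<open>K\<close>; polarization relates the two.\<close>
    have polar: "(\<eta> \<odot> oconj u) \<bullet> (v \<odot> oconj \<xi>) = 2 * p * q - K"
      using omul_inner_polarized [of \<eta> "oconj u" v "oconj \<xi>"]
      by (simp add: defs inner_commute algebra_simps)
    have "\<zeta> \<bullet> \<zeta> = V * X + Y * U + 2 * (2 * p * q - K)"
      using polar by (simp add: defs inner_add_left inner_add_right inner_commute)
    moreover have "(v \<odot> oconj \<xi>) \<bullet> (v \<odot> oconj u) = V * p" "(\<eta> \<odot> oconj u) \<bullet> (v \<odot> oconj u) = q * U"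
      using omul_inner_polarized [of v "oconj \<xi>" v "oconj u"]
        omul_inner_polarized [of \<eta> "oconj u" v "oconj u"]
      by (simp_all add: defs inner_commute)
    hence "\<zeta> \<bullet> (v \<odot> oconj u) = V * p + q * U"
      by (simp add: defs(9) inner_add_left)
    ultimately have \<zeta>: "(\<zeta> - e *\<^sub>R (v \<odot> oconj u)) \<bullet> (\<zeta> - e *\<^sub>R (v \<odot> oconj u)) =
        V * X + Y * U + 2 * (2 * p * q - K) - 2 * e * (V * p + q * U) + e\<^sup>2 * (V * U)"
      by (simp add: inner_diff_left inner_diff_right inner_commute defs(3,4) power2_eq_square
          algebra_simps)
    have scale: "trace_form (r *\<^sub>R P) = r\<^sup>2 * trace_form P" for r P
      by (cases P rule: swap12.cases) (simp add: power2_eq_square algebra_simps)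
    have "D t = inverse N *\<^sub>R (- e, 2 * p - e * U, 2 * q - e * V, \<xi> - e *\<^sub>R u, \<eta> - e *\<^sub>R v,
        \<zeta> - e *\<^sub>R (v \<odot> oconj u))"
      by (simp add: D_def dM_def dN_def M_def w t defs algebra_simps)
    hence "trace_form (D t) = (inverse N)\<^sup>2 * trace_form (- e, 2 * p - e * U, 2 * q - e * V,
        \<xi> - e *\<^sub>R u, \<eta> - e *\<^sub>R v, \<zeta> - e *\<^sub>R (v \<odot> oconj u))"
      by (simp only: scale)
    also have "trace_form (- e, 2 * p - e * U, 2 * q - e * V, \<xi> - e *\<^sub>R u, \<eta> - e *\<^sub>R v,
        \<zeta> - e *\<^sub>R (v \<odot> oconj u)) =
      (e\<^sup>2 + (2 * p - e * U)\<^sup>2 + (2 * q - e * V)\<^sup>2) / 2 + (X - 2 * e * p + e\<^sup>2 * U) -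
      (Y - 2 * e * q + e\<^sup>2 * V) -
      (V * X + Y * U + 2 * (2 * p * q - K) - 2 * e * (V * p + q * U) + e\<^sup>2 * (V * U))"
      unfolding trace_form.simps \<zeta>
      by (simp add: defs(1-6) inner_diff_left inner_diff_right inner_commute power2_eq_square)
    \<comment> \<open>The two sides differ by \<open>(e * N - 2 * (p - q))\<^sup>2 / 2\<close>,
      which vanishes by \<open>eN\<close>.\<close>
    also have "\<dots> = X * (1 - V) - Y * (1 + U) + 2 * K"
      using eN NUV by algebra
    finally have "trace_form (D t) = (X * (1 - V) - Y * (1 + U) + 2 * K) / N\<^sup>2"
      by (simp add: divide_inverse power_inverse)
    moreover have "ore ((u \<odot> oconj v) \<odot> (\<eta> \<odot> oconj \<xi>)) = K"
      by (simp add: ore_eq_inner omul_inner_left [of "u \<odot> oconj v"] defs)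
    ultimately show ?thesis
      by (simp add: gform_def w t onorm2_eq_inner defs N_def)
  qed
  ultimately show ?thesis by blast
qed

lemma open_chart_dom: "open (chart_dom i)"
proof -
  have "chart_dom i = {w. 0 < 1 + fst w \<bullet> fst w - snd w \<bullet> snd w}"
    by (auto simp: chart_dom_eq)
  thus ?thesis
    by (simp add: open_Collect_less continuous_intros)
qed

lemma rational_map_chart_embed: "rational_map (chart_dom i) chart_embed"
proof -
  have "rational_map (chart_dom i) (\<lambda>w. inverse (1 + fst w \<bullet> fst w - snd w \<bullet> snd w) *\<^sub>R
    (1 :: real, fst w \<bullet> fst w, snd w \<bullet> snd w, fst w, snd w, snd w \<odot> oconj (fst w)))"
    by (intro rational_map_intros rational_map_inverse rational_map_add rational_map_diff)
      (auto simp: chart_dom_eq)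
  also have "(\<lambda>w. inverse (1 + fst w \<bullet> fst w - snd w \<bullet> snd w) *\<^sub>R
    (1 :: real, fst w \<bullet> fst w, snd w \<bullet> snd w, fst w, snd w, snd w \<odot> oconj (fst w))) = chart_embed"
    by (rule ext) (metis embed_eq prod.collapse)
  finally show ?thesis .
qed

lemma rational_map_unembed:
  assumes "rational_map S f" "\<And>x. x \<in> S \<Longrightarrow> fst (f x) \<noteq> 0"
  shows "rational_map S (\<lambda>x. unembed (f x))"
  unfolding unembed_def case_prod_unfold
  by (intro rational_map_intros rational_map_inverse assms)

section \<open>Maps of the plane induced by linear maps of matrices\<close>

context
  fixes T :: "herm \<Rightarrow> herm" and F :: "triple set \<Rightarrow> triple set"
  assumes lin: "linear T" and T_proj: "T ` projections \<subseteq> projections"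
    and F: "\<And>P. P \<in> projections \<Longrightarrow> F (point P) = point (T P)"
begin

text \<open>The matrix of the image point, rearranged so that \<open>unembed\<close> reads off its
  coordinates in chart \<open>j\<close>.\<close>

definition local_herm :: "nat \<Rightarrow> nat \<Rightarrow> oct \<times> oct \<Rightarrow> herm" where
  "local_herm i j w = flip j (T (flip i (chart_embed w)))"

lemma local_herm_in_projections: "w \<in> chart_dom i \<Longrightarrow> local_herm i j w \<in> projections"
  using embed_in_projections [of w i] T_proj by (simp add: local_herm_def image_subset_iff)

lemma F_chart_inv: "w \<in> chart_dom i \<Longrightarrow> F (chart_inv i w) = point (T (flip i (chart_embed w)))"
  using embed_in_projections by (simp add: chart_inv_eq F)

text \<open>The domain is where the denominator used by \<open>unembed\<close> does not vanish,
  which yields both its openness and the rationality of the local representation.\<close>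

lemma loc_dom_eq: "loc_dom F i j = {w \<in> chart_dom i. fst (local_herm i j w) \<noteq> 0}"
proof -
  have "F (chart_inv i w) \<in> chart_inv j ` chart_dom j \<longleftrightarrow> fst (local_herm i j w) \<noteq> 0"
    if "w \<in> chart_dom i" for w
    using point_in_chart_iff [of "T (flip i (chart_embed w))" j] F_chart_inv [OF that]
      local_herm_in_projections [OF that, of j] by (simp add: local_herm_def)
  thus ?thesis unfolding loc_dom_def by blast
qed

lemma loc_rep_eq:
  assumes "w \<in> loc_dom F i j"
  shows "loc_rep F i j w = unembed (local_herm i j w)"
    and "chart_embed (loc_rep F i j w) = local_herm i j w"
    and "loc_rep F i j w \<in> chart_dom j"
proof -
  have w: "w \<in> chart_dom i" "fst (local_herm i j w) \<noteq> 0" using assms by (auto simp: loc_dom_eq)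
  show "loc_rep F i j w = unembed (local_herm i j w)"
    using chart_point [of "T (flip i (chart_embed w))" j] F_chart_inv [OF w(1)] w(2)
      local_herm_in_projections [OF w(1), of j] by (simp add: local_herm_def loc_rep_def)
  thus "chart_embed (loc_rep F i j w) = local_herm i j w" "loc_rep F i j w \<in> chart_dom j"
    using embed_unembed local_herm_in_projections w by auto
qed

lemma rational_map_local_herm: "rational_map (chart_dom i) (local_herm i j)"
  unfolding local_herm_def [abs_def]
  using lin by (intro rational_map_linear [OF bounded_linear_flip] rational_map_linear [of T]
      rational_map_chart_embed) (simp add: linear_conv_bounded_linear)

lemma open_loc_dom: "open (loc_dom F i j)"
proof -
  have "continuous_on (chart_dom i) (\<lambda>w. fst (local_herm i j w))"
    by (intro continuous_intros rational_map_continuous rational_map_local_herm)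
  hence "open (chart_dom i \<inter> (\<lambda>w. fst (local_herm i j w)) -` (- {0}))"
    by (intro continuous_open_preimage open_chart_dom) auto
  also have "chart_dom i \<inter> (\<lambda>w. fst (local_herm i j w)) -` (- {0}) = loc_dom F i j"
    by (auto simp: loc_dom_eq)
  finally show ?thesis .
qed

lemma Cinf_on_loc_rep: "Cinf_on (loc_dom F i j) (loc_rep F i j)"
proof (rule Cinf_on_rational_map [OF open_loc_dom _ loc_rep_eq(1)])
  show "rational_map (loc_dom F i j) (\<lambda>w. unembed (local_herm i j w))"
    by (intro rational_map_unembed rational_map_mono [OF rational_map_local_herm])
      (auto simp: loc_dom_eq)
qed

lemma smooth_map_induced: "smooth_map F"
  unfolding smooth_map_def OP11_eq using Cinf_on_loc_rep F T_proj by auto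

text \<open>Since the metric is pulled back along the embedding, the derivative of the local
  representation need not be computed: it is determined by \<open>chart_embed \<circ> loc_rep F i j = local_herm i j\<close>.\<close>

lemma gform_loc_rep:
  assumes tf: "\<And>P. trace_form (T P) = trace_form P" and w: "w \<in> loc_dom F i j"
  shows "\<exists>D. (loc_rep F i j has_derivative D) (at w) \<and>
    (\<forall>t. gform (loc_rep F i j w) (D t) = gform w t)"
proof -
  obtain D where D: "(loc_rep F i j has_derivative D) (at w)"
    using Cinf_on_loc_rep w iter_deriv.base unfolding Cinf_on_def differentiable_def by blast
  have "w \<in> chart_dom i" using w by (simp add: loc_dom_eq)
  then obtain E where E: "(chart_embed has_derivative E) (at w)" "\<And>t. trace_form (E t) = gform w t"
    using chart_embed_has_derivative by blast
  obtain E' where E': "(chart_embed has_derivative E') (at (loc_rep F i j w))"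
    "\<And>t. trace_form (E' t) = gform (loc_rep F i j w) t"
    using chart_embed_has_derivative loc_rep_eq(3) [OF w] by blast
  have "bounded_linear T" using lin by (simp add: linear_conv_bounded_linear)
  hence "(local_herm i j has_derivative (\<lambda>t. flip j (T (flip i (E t))))) (at w)"
    unfolding local_herm_def [abs_def]
    using bounded_linear.has_derivative bounded_linear_flip E(1) by blast
  moreover have "((\<lambda>w. chart_embed (loc_rep F i j w)) has_derivative (\<lambda>t. E' (D t))) (at w)"
    using has_derivative_compose [OF D E'(1)] .
  hence "(local_herm i j has_derivative (\<lambda>t. E' (D t))) (at w)"
    by (rule has_derivative_transform_within_open [OF _ open_loc_dom w]) (rule loc_rep_eq(2))
  ultimately have "(\<lambda>t. flip j (T (flip i (E t)))) = (\<lambda>t. E' (D t))"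
    by (rule has_derivative_unique)
  hence "gform (loc_rep F i j w) (D t) = gform w t" for t
    by (metis E(2) E'(2) tf trace_form_flip)
  thus ?thesis using D by blast
qed

end

text \<open>The inverse is carried along because smoothness of the inverse map is obtained by
  inducing that map from \<open>T'\<close>.\<close>

definition herm_automorphism :: "(herm \<Rightarrow> herm) \<Rightarrow> (herm \<Rightarrow> herm) \<Rightarrow> bool" where
  "herm_automorphism T T' \<longleftrightarrow> linear T \<and> linear T' \<and> (\<forall>P. T (T' P) = P) \<and> (\<forall>P. T' (T P) = P) \<and>
     (\<forall>P\<in>projections. T P \<in> projections) \<and> (\<forall>P\<in>projections. T' P \<in> projections) \<and>
     (\<forall>P. trace_form (T P) = trace_form P)"

lemma herm_automorphism_sym: "herm_automorphism T T' \<Longrightarrow> herm_automorphism T' T"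
  unfolding herm_automorphism_def by metis

lemma herm_automorphism_compose:
  "herm_automorphism S S' \<Longrightarrow> herm_automorphism T T' \<Longrightarrow> herm_automorphism (S \<circ> T) (T' \<circ> S')"
  unfolding herm_automorphism_def by (simp add: linear_compose)

lemma isometry_induced:
  assumes T: "herm_automorphism T T'"
  shows "\<exists>F. isometry F \<and> (\<forall>P\<in>projections. F (point P) = point (T P))"
proof -
  define F where "F X = point (T (inv_into projections point X))" for X
  have F: "F (point P) = point (T P)" if "P \<in> projections" for P
    using that by (simp add: F_def inj_on_point)
  have TT': "linear T" "linear T'" "\<And>P. T (T' P) = P" "\<And>P. T' (T P) = P"
    "T ` projections \<subseteq> projections" "T' ` projections \<subseteq> projections"
    "\<And>P. trace_form (T P) = trace_form P"
    using T unfolding herm_automorphism_def image_subset_iff by blast+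
  have bij: "bij_betw F OP11 OP11"
  proof (rule bij_betwI')
    fix X Y assume "X \<in> OP11" "Y \<in> OP11"
    then obtain P Q where PQ: "X = point P" "Y = point Q" "P \<in> projections" "Q \<in> projections"
      by (auto simp: OP11_eq)
    moreover have "T P = T Q \<longleftrightarrow> P = Q" by (metis TT'(4))
    moreover have "T P \<in> projections" "T Q \<in> projections" using PQ TT'(5) by blast+
    ultimately show "F X = F Y \<longleftrightarrow> X = Y"
      by (simp add: F inj_on_eq_iff [OF inj_on_point])
  next
    fix X assume "X \<in> OP11"
    thus "F X \<in> OP11" using F TT'(5) by (auto simp: OP11_eq)
  next
    fix Y assume "Y \<in> OP11"
    then obtain Q where Q: "Q \<in> projections" "Y = point Q" by (auto simp: OP11_eq)
    hence "T' Q \<in> projections" using TT'(6) by blast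
    hence "Y = F (point (T' Q))" "point (T' Q) \<in> OP11"
      using F TT'(3) Q by (simp_all add: OP11_eq)
    thus "\<exists>X\<in>OP11. Y = F X" by blast
  qed
  \<comment> \<open>The inverse of \<open>F\<close> is induced by \<open>T'\<close>, so the results
    for induced maps apply to it as well.\<close>
  have F': "inv_into OP11 F (point P) = point (T' P)" if "P \<in> projections" for P
  proof (rule inv_into_f_eq)
    show "inj_on F OP11" using bij by (rule bij_betw_imp_inj_on)
    show "point (T' P) \<in> OP11" using that TT'(6) by (auto simp: OP11_eq)
    show "F (point (T' P)) = point P" using that TT'(3,6) F [of "T' P"] by auto
  qed
  have "isometry F"
    unfolding isometry_def
    using bij smooth_map_induced [OF TT'(1,5) F] smooth_map_induced [OF TT'(2,6) F']
      gform_loc_rep [OF TT'(1,5) F TT'(7)] by blast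
  thus ?thesis using F by blast
qed

section \<open>Rotations, boosts and triality\<close>

text \<open>Adjointness turns the product relations into values of mixed inner products, which
  appear when norms of sums of entries are expanded.\<close>

lemma projectionsD:
  assumes "(\<alpha>, \<beta>, \<gamma>, x, y, z) \<in> projections"
  shows "\<alpha> + \<beta> - \<gamma> = 1" "0 \<le> \<alpha>" "0 \<le> \<beta>" "0 \<le> \<gamma>"
    "x \<bullet> x = \<alpha> * \<beta>" "y \<bullet> y = \<alpha> * \<gamma>" "z \<bullet> z = \<beta> * \<gamma>"
    "z \<odot> x = \<beta> *\<^sub>R y" "y \<odot> oconj x = \<alpha> *\<^sub>R z" "oconj z \<odot> y = \<gamma> *\<^sub>R x"
    "y \<bullet> z = \<gamma> * (x \<bullet> oone)" "x \<bullet> oconj z = \<beta> * (y \<bullet> oone)"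
    "oconj x \<odot> oconj z = \<beta> *\<^sub>R oconj y" "x \<odot> oconj y = \<alpha> *\<^sub>R oconj z"
    "oconj y \<odot> z = \<gamma> *\<^sub>R oconj x"
proof -
  show eqs: "\<alpha> + \<beta> - \<gamma> = 1" "0 \<le> \<gamma>" "x \<bullet> x = \<alpha> * \<beta>" "y \<bullet> y = \<alpha> * \<gamma>" "z \<bullet> z = \<beta> * \<gamma>"
    "z \<odot> x = \<beta> *\<^sub>R y" "y \<odot> oconj x = \<alpha> *\<^sub>R z" "oconj z \<odot> y = \<gamma> *\<^sub>R x"
    using assms by (auto simp: projections_def)
  have "0 \<le> \<alpha> * \<beta>"
    using inner_ge_zero [of x] by (simp add: eqs)
  thus "0 \<le> \<alpha>" "0 \<le> \<beta>"
    using eqs(1,2) by (auto simp: zero_le_mult_iff)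
  show "y \<bullet> z = \<gamma> * (x \<bullet> oone)"
    using omul_inner_left [of "oconj z" y oone] by (simp add: eqs)
  show "x \<bullet> oconj z = \<beta> * (y \<bullet> oone)"
    using omul_inner_left [of z x oone] by (simp add: eqs)
  show "oconj x \<odot> oconj z = \<beta> *\<^sub>R oconj y" "x \<odot> oconj y = \<alpha> *\<^sub>R oconj z"
    "oconj y \<odot> z = \<gamma> *\<^sub>R oconj x"
    using arg_cong [OF eqs(6), of oconj] arg_cong [OF eqs(7), of oconj] arg_cong [OF eqs(8), of oconj]
    by simp_all
qed

text \<open>Conjugation of Hermitian matrices by a real rotation in the first two coordinates. The
  entries \<open>c\<^sup>2 \<alpha> - 2 c s Re x + s\<^sup>2 \<beta>\<close> and \<open>c\<^sup>2 x - s\<^sup>2 x\<^sup>* + c s (\<alpha> - \<beta>)\<close> have been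
  simplified by \<open>c\<^sup>2 + s\<^sup>2 = 1\<close>.\<close>

fun rotation :: "real \<Rightarrow> real \<Rightarrow> herm \<Rightarrow> herm" where
  "rotation c s (\<alpha>, \<beta>, \<gamma>, x, y, z) =
    (\<alpha> - s * (s * (\<alpha> - \<beta>) + 2 * c * (x \<bullet> oone)),
     \<beta> + s * (s * (\<alpha> - \<beta>) + 2 * c * (x \<bullet> oone)),
     \<gamma>,
     x + (s * (c * (\<alpha> - \<beta>) - 2 * s * (x \<bullet> oone))) *\<^sub>R oone,
     c *\<^sub>R y - s *\<^sub>R z,
     s *\<^sub>R y + c *\<^sub>R z)"

lemma linear_rotation: "linear (rotation c s)"
proof (rule linearI)
  show "rotation c s (P + Q) = rotation c s P + rotation c s Q" for P Q
    by (cases P rule: swap12.cases; cases Q rule: swap12.cases)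
      (simp add: inner_add_left algebra_simps)
  show "rotation c s (r *\<^sub>R P) = r *\<^sub>R rotation c s P" for r P
    by (cases P rule: swap12.cases) (simp add: algebra_simps)
qed

text \<open>For \<open>d = \<alpha> - \<beta>\<close> and \<rho> the real part of \<open>x\<close>,
  a rotation shifts the diagonal by \<open>m\<close> and the real part of \<open>x\<close> by
  \<open>k\<close>. Each identity holds exactly once a factor \<open>c\<^sup>2 + s\<^sup>2\<close>
  is inserted on the right.\<close>

lemma rotation_coefficients:
  fixes c s d \<rho> :: real
  assumes cs: "c\<^sup>2 + s\<^sup>2 = 1" and m: "m = s * (s * d + 2 * c * \<rho>)" and k: "k = s * (c * d - 2 * s * \<rho>)"
  shows "s * m + c * k = s * d" "c * m - s * k = 2 * s * \<rho>" "m\<^sup>2 + k\<^sup>2 = m * d - 2 * k * \<rho>"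
proof -
  have "s * m + c * k = (c\<^sup>2 + s\<^sup>2) * (s * d)" "c * m - s * k = (c\<^sup>2 + s\<^sup>2) * (2 * s * \<rho>)"
    "m\<^sup>2 + k\<^sup>2 = (c\<^sup>2 + s\<^sup>2) * (m * d - 2 * k * \<rho>)"
    by (simp_all add: m k power2_eq_square algebra_simps)
  thus "s * m + c * k = s * d" "c * m - s * k = 2 * s * \<rho>" "m\<^sup>2 + k\<^sup>2 = m * d - 2 * k * \<rho>"
    by (simp_all add: cs)
qed

lemma rotation_in_projections:
  assumes cs: "c\<^sup>2 + s\<^sup>2 = 1" and P: "P \<in> projections"
  shows "rotation c s P \<in> projections"
proof -
  obtain \<alpha> \<beta> \<gamma> x y z where P': "P = (\<alpha>, \<beta>, \<gamma>, x, y, z)"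
    by (cases P rule: swap12.cases)
  note eqs = projectionsD [OF P [unfolded P']]
  define \<rho> where "\<rho> = x \<bullet> oone"
  define m k where mk: "m = s * (s * (\<alpha> - \<beta>) + 2 * c * \<rho>)" "k = s * (c * (\<alpha> - \<beta>) - 2 * s * \<rho>)"
  note coeffs = rotation_coefficients [OF cs mk]
  \<comment> \<open>The unsimplified diagonal entries are the ones that appear in the norms of
    \<open>y'\<close> and \<open>z'\<close>.\<close>
  have diag: "\<alpha> - m = c\<^sup>2 * \<alpha> - 2 * c * s * \<rho> + s\<^sup>2 * \<beta>" "\<beta> + m = s\<^sup>2 * \<alpha> + 2 * c * s * \<rho> + c\<^sup>2 * \<beta>"
    using cs unfolding mk by algebra+
  define x' y' z' where xyz: "x' = x + k *\<^sub>R oone" "y' = c *\<^sub>R y - s *\<^sub>R z" "z' = s *\<^sub>R y + c *\<^sub>R z"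
  have yx: "y \<odot> x = (2 * \<rho>) *\<^sub>R y - \<alpha> *\<^sub>R z" and zx: "z \<odot> oconj x = (2 * \<rho>) *\<^sub>R z - \<beta> *\<^sub>R y"
    using omul_as_oconj(2) [of y x] omul_as_oconj(2) [of z x] by (simp_all add: eqs \<rho>_def)
  have "(\<alpha> - m) + (\<beta> + m) - \<gamma> = 1"
    using eqs(1) by simp
  moreover have "x' \<bullet> x' = (\<alpha> - m) * (\<beta> + m)"
  proof -
    have "x' \<bullet> x' = \<alpha> * \<beta> + 2 * k * \<rho> + k\<^sup>2"
      by (simp add: xyz inner_add_oone eqs \<rho>_def)
    thus ?thesis using coeffs(3) by algebra
  qed
  moreover have "y' \<bullet> y' = (\<alpha> - m) * \<gamma>" "z' \<bullet> z' = (\<beta> + m) * \<gamma>"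
    unfolding diag
    by (simp_all add: xyz inner_add_left inner_add_right inner_diff_left inner_diff_right
        inner_commute [of z y] eqs \<rho>_def power2_eq_square algebra_simps)
  moreover have "z' \<odot> x' = (\<beta> + m) *\<^sub>R y'"
  proof -
    have "z' \<odot> x' = (2 * s * \<rho> + c * \<beta> + s * k) *\<^sub>R y + (c * k - s * \<alpha>) *\<^sub>R z"
      by (simp add: xyz omul_distrib eqs yx algebra_simps)
    also have "2 * s * \<rho> + c * \<beta> + s * k = (\<beta> + m) * c"
      using coeffs(2) by algebra
    also have "c * k - s * \<alpha> = - ((\<beta> + m) * s)"
      using coeffs(1) by algebra
    finally show ?thesis by (simp add: xyz scaleR_diff_right)
  qed
  moreover have "y' \<odot> oconj x' = (\<alpha> - m) *\<^sub>R z'"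
  proof -
    have "y' \<odot> oconj x' = (s * \<beta> + c * k) *\<^sub>R y + (c * \<alpha> - 2 * s * \<rho> - s * k) *\<^sub>R z"
      by (simp add: xyz omul_distrib eqs zx algebra_simps)
    also have "s * \<beta> + c * k = (\<alpha> - m) * s"
      using coeffs(1) by algebra
    also have "c * \<alpha> - 2 * s * \<rho> - s * k = (\<alpha> - m) * c"
      using coeffs(2) by algebra
    finally show ?thesis by (simp add: xyz scaleR_add_right)
  qed
  moreover have "oconj z' \<odot> y' = \<gamma> *\<^sub>R x'"
  proof -
    have "oconj z' \<odot> y' = (\<gamma> * (c\<^sup>2 + s\<^sup>2)) *\<^sub>R x + (\<gamma> * k) *\<^sub>R oone"
      by (simp add: xyz omul_distrib eqs oconj_eq [of x] mk \<rho>_def algebra_simps power2_eq_square)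
    thus ?thesis by (simp add: xyz cs scaleR_add_right)
  qed
  ultimately have "(\<alpha> - m, \<beta> + m, \<gamma>, x', y', z') \<in> projections"
    using eqs(4) by (simp add: projections_def)
  thus ?thesis by (simp add: P' xyz mk \<rho>_def)
qed

lemma trace_form_rotation:
  assumes cs: "c\<^sup>2 + s\<^sup>2 = 1"
  shows "trace_form (rotation c s P) = trace_form P"
proof -
  obtain \<alpha> \<beta> \<gamma> x y z where P: "P = (\<alpha>, \<beta>, \<gamma>, x, y, z)"
    by (cases P rule: swap12.cases)
  define \<rho> where "\<rho> = x \<bullet> oone"
  define m k where mk: "m = s * (s * (\<alpha> - \<beta>) + 2 * c * \<rho>)" "k = s * (c * (\<alpha> - \<beta>) - 2 * s * \<rho>)"
  have "rotation c s P = (\<alpha> - m, \<beta> + m, \<gamma>, x + k *\<^sub>R oone, c *\<^sub>R y - s *\<^sub>R z, s *\<^sub>R y + c *\<^sub>R z)"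
    by (simp add: P mk \<rho>_def)
  moreover have "(x + k *\<^sub>R oone) \<bullet> (x + k *\<^sub>R oone) = x \<bullet> x + 2 * k * \<rho> + k\<^sup>2"
    by (simp add: inner_add_oone \<rho>_def)
  moreover have "(c *\<^sub>R y - s *\<^sub>R z) \<bullet> (c *\<^sub>R y - s *\<^sub>R z) + (s *\<^sub>R y + c *\<^sub>R z) \<bullet> (s *\<^sub>R y + c *\<^sub>R z) =
      (c\<^sup>2 + s\<^sup>2) * (y \<bullet> y + z \<bullet> z)"
    by (simp add: inner_add_left inner_add_right inner_diff_left inner_diff_right
        inner_commute [of z y] power2_eq_square algebra_simps)
  ultimately have "trace_form (rotation c s P) =
      ((\<alpha> - m)\<^sup>2 + (\<beta> + m)\<^sup>2 + \<gamma>\<^sup>2) / 2 + (x \<bullet> x + 2 * k * \<rho> + k\<^sup>2) - (y \<bullet> y + z \<bullet> z)"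
    using cs by (simp only: trace_form.simps) simp
  also have "\<dots> = (\<alpha>\<^sup>2 + \<beta>\<^sup>2 + \<gamma>\<^sup>2) / 2 + x \<bullet> x - y \<bullet> y - z \<bullet> z"
    using rotation_coefficients(3) [OF cs mk] by algebra
  finally show ?thesis by (simp add: P)
qed

lemma rotation_inverse:
  assumes cs: "c\<^sup>2 + s\<^sup>2 = 1"
  shows "rotation c (- s) (rotation c s P) = P"
proof -
  obtain \<alpha> \<beta> \<gamma> x y z where P: "P = (\<alpha>, \<beta>, \<gamma>, x, y, z)"
    by (cases P rule: swap12.cases)
  define \<rho> where "\<rho> = x \<bullet> oone"
  define m k where mk: "m = s * (s * (\<alpha> - \<beta>) + 2 * c * \<rho>)" "k = s * (c * (\<alpha> - \<beta>) - 2 * s * \<rho>)"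
  have 1: "rotation c s P = (\<alpha> - m, \<beta> + m, \<gamma>, x + k *\<^sub>R oone, c *\<^sub>R y - s *\<^sub>R z, s *\<^sub>R y + c *\<^sub>R z)"
    by (simp add: P mk \<rho>_def)
  have "- s * (- s * (\<alpha> - m - (\<beta> + m)) + 2 * c * (\<rho> + k)) = - m"
    "- s * (c * (\<alpha> - m - (\<beta> + m)) - 2 * - s * (\<rho> + k)) = - k"
    using rotation_coefficients(1,2) [OF cs mk] mk by algebra+
  moreover have "(x + k *\<^sub>R oone) \<bullet> oone = \<rho> + k"
    by (simp add: inner_add_left \<rho>_def)
  moreover have "c *\<^sub>R (c *\<^sub>R y - s *\<^sub>R z) - (- s) *\<^sub>R (s *\<^sub>R y + c *\<^sub>R z) = (c\<^sup>2 + s\<^sup>2) *\<^sub>R y"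
    "- s *\<^sub>R (c *\<^sub>R y - s *\<^sub>R z) + c *\<^sub>R (s *\<^sub>R y + c *\<^sub>R z) = (c\<^sup>2 + s\<^sup>2) *\<^sub>R z"
    by (simp_all add: power2_eq_square algebra_simps)
  ultimately show ?thesis
    unfolding 1 rotation.simps by (simp only: cs) (simp add: P)
qed

lemma herm_automorphism_rotation:
  assumes "c\<^sup>2 + s\<^sup>2 = 1"
  shows "herm_automorphism (rotation c s) (rotation c (- s))"
  using assms rotation_inverse [of c s] rotation_inverse [of c "- s"]
  by (simp add: herm_automorphism_def linear_rotation rotation_in_projections trace_form_rotation)

text \<open>Conjugation of the matrix by a hyperbolic rotation in the first and third coordinates,
  simplified by \<open>c\<^sup>2 - s\<^sup>2 = 1\<close>. It mixes \<open>x\<close> with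
  \<open>oconj z\<close>, since these entries lie in the same row of the matrix.\<close>

fun boost :: "real \<Rightarrow> real \<Rightarrow> herm \<Rightarrow> herm" where
  "boost c s (\<alpha>, \<beta>, \<gamma>, x, y, z) =
    (\<alpha> + s * (s * (\<alpha> + \<gamma>) + 2 * c * (y \<bullet> oone)),
     \<beta>,
     \<gamma> + s * (s * (\<alpha> + \<gamma>) + 2 * c * (y \<bullet> oone)),
     c *\<^sub>R x + s *\<^sub>R oconj z,
     y + (s * (c * (\<alpha> + \<gamma>) + 2 * s * (y \<bullet> oone))) *\<^sub>R oone,
     s *\<^sub>R oconj x + c *\<^sub>R z)"

lemma linear_boost: "linear (boost c s)"
proof (rule linearI)
  show "boost c s (P + Q) = boost c s P + boost c s Q" for P Q
    by (cases P rule: swap12.cases; cases Q rule: swap12.cases)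
      (simp add: inner_add_left algebra_simps)
  show "boost c s (r *\<^sub>R P) = r *\<^sub>R boost c s P" for r P
    by (cases P rule: swap12.cases) (simp add: algebra_simps)
qed

text \<open>The hyperbolic counterpart of \<open>rotation_coefficients\<close>: \<open>m\<close> is
  the common increment of \<alpha> and \<gamma>, and \<open>k\<close> that of the real part of
  \<open>y\<close>.\<close>

lemma boost_coefficients:
  fixes c s d \<sigma> :: real
  assumes cs: "c\<^sup>2 - s\<^sup>2 = 1" and m: "m = s * (s * d + 2 * c * \<sigma>)" and k: "k = s * (c * d + 2 * s * \<sigma>)"
  shows "c * k - s * m = s * d" "c * m - s * k = 2 * s * \<sigma>" "k\<^sup>2 - m\<^sup>2 = m * d - 2 * k * \<sigma>"
proof -
  have "c * k - s * m = (c\<^sup>2 - s\<^sup>2) * (s * d)" "c * m - s * k = (c\<^sup>2 - s\<^sup>2) * (2 * s * \<sigma>)"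
    "k\<^sup>2 - m\<^sup>2 = (c\<^sup>2 - s\<^sup>2) * (m * d - 2 * k * \<sigma>)"
    by (simp_all add: m k power2_eq_square algebra_simps)
  thus "c * k - s * m = s * d" "c * m - s * k = 2 * s * \<sigma>" "k\<^sup>2 - m\<^sup>2 = m * d - 2 * k * \<sigma>"
    by (simp_all add: cs)
qed

lemma boost_in_projections:
  assumes cs: "c\<^sup>2 - s\<^sup>2 = 1" and P: "P \<in> projections"
  shows "boost c s P \<in> projections"
proof -
  obtain \<alpha> \<beta> \<gamma> x y z where P': "P = (\<alpha>, \<beta>, \<gamma>, x, y, z)"
    by (cases P rule: swap12.cases)
  note eqs = projectionsD [OF P [unfolded P']]
  define \<sigma> where "\<sigma> = y \<bullet> oone"
  define m k where mk: "m = s * (s * (\<alpha> + \<gamma>) + 2 * c * \<sigma>)" "k = s * (c * (\<alpha> + \<gamma>) + 2 * s * \<sigma>)"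
  note coeffs = boost_coefficients [OF cs mk]
  have diag: "\<alpha> + m = c\<^sup>2 * \<alpha> + 2 * c * s * \<sigma> + s\<^sup>2 * \<gamma>" "\<gamma> + m = s\<^sup>2 * \<alpha> + 2 * c * s * \<sigma> + c\<^sup>2 * \<gamma>"
    using cs unfolding mk by algebra+
  define x' y' z' where xyz: "x' = c *\<^sub>R x + s *\<^sub>R oconj z" "y' = y + k *\<^sub>R oone"
    "z' = s *\<^sub>R oconj x + c *\<^sub>R z"
  have yz: "y \<odot> z = (2 * \<sigma>) *\<^sub>R z - \<gamma> *\<^sub>R oconj x" and xy: "x \<odot> y = (2 * \<sigma>) *\<^sub>R x - \<alpha> *\<^sub>R oconj z"
    using omul_as_oconj(1) [of y z] omul_as_oconj(2) [of x y] by (simp_all add: eqs \<sigma>_def)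
  have "(\<alpha> + m) + \<beta> - (\<gamma> + m) = 1"
    using eqs(1) by simp
  \<comment> \<open>Cauchy-Schwarz for \<open>y\<close> and \<open>oone\<close>, followed by the
    arithmetic-geometric mean inequality, bounds the mixed term of the unsimplified entry by the two
    nonnegative ones.\<close>
  moreover have "0 \<le> \<gamma> + m"
  proof -
    have "(2 * c * s * \<sigma>)\<^sup>2 \<le> 4 * (s\<^sup>2 * \<alpha>) * (c\<^sup>2 * \<gamma>)"
      using mult_left_mono [OF Cauchy_Schwarz_ineq [of y oone], of "4 * c\<^sup>2 * s\<^sup>2"]
      by (simp add: eqs \<sigma>_def power_mult_distrib mult_ac)
    also have "\<dots> \<le> (s\<^sup>2 * \<alpha> + c\<^sup>2 * \<gamma>)\<^sup>2"
      using sum_squares_bound [of "s\<^sup>2 * \<alpha>" "c\<^sup>2 * \<gamma>"] unfolding power2_sum by linarith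
    finally have "\<bar>2 * c * s * \<sigma>\<bar> \<le> s\<^sup>2 * \<alpha> + c\<^sup>2 * \<gamma>"
      using eqs(2,4) by (simp flip: abs_le_square_iff)
    thus ?thesis unfolding diag by linarith
  qed
  moreover have "y' \<bullet> y' = (\<alpha> + m) * (\<gamma> + m)"
  proof -
    have "y' \<bullet> y' = \<alpha> * \<gamma> + 2 * k * \<sigma> + k\<^sup>2"
      by (simp add: xyz inner_add_oone eqs \<sigma>_def)
    thus ?thesis using coeffs(3) by algebra
  qed
  moreover have "x' \<bullet> x' = (\<alpha> + m) * \<beta>" "z' \<bullet> z' = \<beta> * (\<gamma> + m)"
    unfolding diag
    by (simp_all add: xyz inner_add_left inner_add_right inner_oconj_left
        inner_oconj_commute [of z x] eqs \<sigma>_def power2_eq_square algebra_simps)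
  moreover have "z' \<odot> x' = \<beta> *\<^sub>R y'"
  proof -
    have "z' \<odot> x' = (\<beta> * (c\<^sup>2 - s\<^sup>2)) *\<^sub>R y + (\<beta> * k) *\<^sub>R oone"
      by (simp add: xyz omul_distrib eqs oconj_eq [of y] mk \<sigma>_def algebra_simps power2_eq_square)
    thus ?thesis by (simp add: xyz cs scaleR_add_right)
  qed
  moreover have "y' \<odot> oconj x' = (\<alpha> + m) *\<^sub>R z'"
  proof -
    have "y' \<odot> oconj x' = (c * k - s * \<gamma>) *\<^sub>R oconj x + (c * \<alpha> + 2 * s * \<sigma> + s * k) *\<^sub>R z"
      by (simp add: xyz omul_distrib eqs yz algebra_simps)
    also have "c * k - s * \<gamma> = (\<alpha> + m) * s"
      using coeffs(1) by algebra
    also have "c * \<alpha> + 2 * s * \<sigma> + s * k = (\<alpha> + m) * c"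
      using coeffs(2) by algebra
    finally show ?thesis by (simp add: xyz scaleR_add_right)
  qed
  moreover have "oconj z' \<odot> y' = (\<gamma> + m) *\<^sub>R x'"
  proof -
    have "oconj z' \<odot> y' = (2 * s * \<sigma> + c * \<gamma> + s * k) *\<^sub>R x + (c * k - s * \<alpha>) *\<^sub>R oconj z"
      by (simp add: xyz omul_distrib eqs xy algebra_simps)
    also have "2 * s * \<sigma> + c * \<gamma> + s * k = (\<gamma> + m) * c"
      using coeffs(2) by algebra
    also have "c * k - s * \<alpha> = (\<gamma> + m) * s"
      using coeffs(1) by algebra
    finally show ?thesis by (simp add: xyz scaleR_add_right)
  qed
  ultimately have "(\<alpha> + m, \<beta>, \<gamma> + m, x', y', z') \<in> projections"
    by (simp add: projections_def)
  thus ?thesis by (simp add: P' xyz mk \<sigma>_def)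
qed

lemma trace_form_boost:
  assumes cs: "c\<^sup>2 - s\<^sup>2 = 1"
  shows "trace_form (boost c s P) = trace_form P"
proof -
  obtain \<alpha> \<beta> \<gamma> x y z where P: "P = (\<alpha>, \<beta>, \<gamma>, x, y, z)"
    by (cases P rule: swap12.cases)
  define \<sigma> where "\<sigma> = y \<bullet> oone"
  define m k where mk: "m = s * (s * (\<alpha> + \<gamma>) + 2 * c * \<sigma>)" "k = s * (c * (\<alpha> + \<gamma>) + 2 * s * \<sigma>)"
  have "boost c s P = (\<alpha> + m, \<beta>, \<gamma> + m, c *\<^sub>R x + s *\<^sub>R oconj z, y + k *\<^sub>R oone, s *\<^sub>R oconj x + c *\<^sub>R z)"
    by (simp add: P mk \<sigma>_def)
  moreover have "(y + k *\<^sub>R oone) \<bullet> (y + k *\<^sub>R oone) = y \<bullet> y + 2 * k * \<sigma> + k\<^sup>2"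
    by (simp add: inner_add_oone \<sigma>_def)
  moreover have "(c *\<^sub>R x + s *\<^sub>R oconj z) \<bullet> (c *\<^sub>R x + s *\<^sub>R oconj z) -
      (s *\<^sub>R oconj x + c *\<^sub>R z) \<bullet> (s *\<^sub>R oconj x + c *\<^sub>R z) = (c\<^sup>2 - s\<^sup>2) * (x \<bullet> x - z \<bullet> z)"
    by (simp add: inner_add_left inner_add_right inner_oconj_left inner_oconj_commute [of z x]
        power2_eq_square algebra_simps)
  ultimately have "trace_form (boost c s P) =
      ((\<alpha> + m)\<^sup>2 + \<beta>\<^sup>2 + (\<gamma> + m)\<^sup>2) / 2 - (y \<bullet> y + 2 * k * \<sigma> + k\<^sup>2) + (x \<bullet> x - z \<bullet> z)"
    using cs by (simp only: trace_form.simps) simp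
  also have "\<dots> = (\<alpha>\<^sup>2 + \<beta>\<^sup>2 + \<gamma>\<^sup>2) / 2 + x \<bullet> x - y \<bullet> y - z \<bullet> z"
    using boost_coefficients(3) [OF cs mk] by algebra
  finally show ?thesis by (simp add: P)
qed

lemma boost_inverse:
  assumes cs: "c\<^sup>2 - s\<^sup>2 = 1"
  shows "boost c (- s) (boost c s P) = P"
proof -
  obtain \<alpha> \<beta> \<gamma> x y z where P: "P = (\<alpha>, \<beta>, \<gamma>, x, y, z)"
    by (cases P rule: swap12.cases)
  define \<sigma> where "\<sigma> = y \<bullet> oone"
  define m k where mk: "m = s * (s * (\<alpha> + \<gamma>) + 2 * c * \<sigma>)" "k = s * (c * (\<alpha> + \<gamma>) + 2 * s * \<sigma>)"
  have 1: "boost c s P =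
      (\<alpha> + m, \<beta>, \<gamma> + m, c *\<^sub>R x + s *\<^sub>R oconj z, y + k *\<^sub>R oone, s *\<^sub>R oconj x + c *\<^sub>R z)"
    by (simp add: P mk \<sigma>_def)
  have "- s * (- s * (\<alpha> + m + (\<gamma> + m)) + 2 * c * (\<sigma> + k)) = - m"
    "- s * (c * (\<alpha> + m + (\<gamma> + m)) + 2 * - s * (\<sigma> + k)) = - k"
    using boost_coefficients(1,2) [OF cs mk] mk by algebra+
  moreover have "(y + k *\<^sub>R oone) \<bullet> oone = \<sigma> + k"
    by (simp add: inner_add_left \<sigma>_def)
  moreover have "c *\<^sub>R (c *\<^sub>R x + s *\<^sub>R oconj z) + - s *\<^sub>R oconj (s *\<^sub>R oconj x + c *\<^sub>R z) = (c\<^sup>2 - s\<^sup>2) *\<^sub>R x"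
    "- s *\<^sub>R oconj (c *\<^sub>R x + s *\<^sub>R oconj z) + c *\<^sub>R (s *\<^sub>R oconj x + c *\<^sub>R z) = (c\<^sup>2 - s\<^sup>2) *\<^sub>R z"
    by (simp_all add: power2_eq_square algebra_simps)
  ultimately show ?thesis
    unfolding 1 boost.simps by (simp only: cs) (simp add: P)
qed

lemma herm_automorphism_boost:
  assumes "c\<^sup>2 - s\<^sup>2 = 1"
  shows "herm_automorphism (boost c s) (boost c (- s))"
  using assms boost_inverse [of c s] boost_inverse [of c "- s"]
  by (simp add: herm_automorphism_def linear_boost boost_in_projections trace_form_boost)

section \<open>Triality maps of unit octonions\<close>

fun triality :: "oct \<Rightarrow> herm \<Rightarrow> herm" where
  "triality a (\<alpha>, \<beta>, \<gamma>, x, y, z) = (\<alpha>, \<beta>, \<gamma>, oconj a \<odot> x, a \<odot> y, (a \<odot> z) \<odot> a)"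

lemma linear_triality: "linear (triality a)"
proof (rule linearI)
  show "triality a (P + Q) = triality a P + triality a Q" for P Q
    by (cases P rule: swap12.cases; cases Q rule: swap12.cases) (simp add: omul_distrib)
  show "triality a (r *\<^sub>R P) = r *\<^sub>R triality a P" for r P
    by (cases P rule: swap12.cases) simp
qed

text \<open>The three product relations are preserved by the left Moufang identity for
  \<open>a\<close>, the middle one, and the left one for \<open>oconj a\<close>,
  respectively.\<close>

lemma triality_in_projections:
  assumes a: "a \<bullet> a = 1" and P: "P \<in> projections"
  shows "triality a P \<in> projections"
proof -
  obtain \<alpha> \<beta> \<gamma> x y z where P': "P = (\<alpha>, \<beta>, \<gamma>, x, y, z)"
    by (cases P rule: swap12.cases)
  note eqs = projectionsD [OF P [unfolded P']]
  have "((a \<odot> z) \<odot> a) \<odot> (oconj a \<odot> x) = \<beta> *\<^sub>R (a \<odot> y)"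
    by (simp add: Moufang_left a eqs)
  moreover have "(a \<odot> y) \<odot> oconj (oconj a \<odot> x) = \<alpha> *\<^sub>R ((a \<odot> z) \<odot> a)"
    by (simp add: Moufang_middle eqs)
  moreover have "oconj ((a \<odot> z) \<odot> a) \<odot> (a \<odot> y) = \<gamma> *\<^sub>R (oconj a \<odot> x)"
    using Moufang_left [of "oconj a" "oconj z" y] Moufang_middle [of "oconj a" oone "oconj z"]
    by (simp add: a eqs)
  moreover have "((a \<odot> z) \<odot> a) \<bullet> ((a \<odot> z) \<odot> a) = \<beta> * \<gamma>"
    by (simp add: a eqs)
  ultimately show ?thesis
    using eqs by (simp add: P' projections_def a)
qed

lemma triality_inverse:
  assumes a: "a \<bullet> a = 1"
  shows "triality (oconj a) (triality a P) = P"
proof -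
  \<comment> \<open>The middle Moufang identity moves the brackets so that the factors cancel first
    on the right and then on the left.\<close>
  have "(oconj a \<odot> ((a \<odot> z) \<odot> a)) \<odot> oconj a = z" for z
    using Moufang_middle [of "oconj a" oone "(a \<odot> z) \<odot> a"] by (simp add: a)
  thus ?thesis by (cases P rule: swap12.cases) (simp add: a)
qed

lemma herm_automorphism_triality:
  assumes "a \<bullet> a = 1"
  shows "herm_automorphism (triality a) (triality (oconj a))"
proof -
  have "trace_form (triality a P) = trace_form P" for P
    by (cases P rule: swap12.cases) (simp add: assms)
  thus ?thesis
    using assms triality_inverse [of a] triality_inverse [of "oconj a"]
    by (simp add: herm_automorphism_def linear_triality triality_in_projections)
qed

section \<open>Transitivity\<close>

lemma norm_entry: "x \<bullet> x = a * b \<Longrightarrow> norm x = sqrt a * sqrt b"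
  by (simp add: norm_eq_sqrt_inner real_sqrt_mult)

lemma herm_automorphism_to_origin:
  assumes P: "P \<in> projections"
  shows "\<exists>T T'. herm_automorphism T T' \<and> T P = (1, 0, 0, 0, 0, 0)"
proof -
  obtain \<alpha> \<beta> \<gamma> x y z where P': "P = (\<alpha>, \<beta>, \<gamma>, x, y, z)"
    by (cases P rule: swap12.cases)
  obtain a where a: "a \<bullet> a = 1" "a \<odot> x = norm x *\<^sub>R oone"
    by (rule unit_multiple_exists)
  \<comment> \<open>\<open>triality\<close> multiplies \<open>x\<close> by the conjugate of its
    parameter, hence the parameter \<open>oconj a\<close>.\<close>
  define T1 where "T1 = triality (oconj a)"
  obtain y1 z1 where P1: "T1 P = (\<alpha>, \<beta>, \<gamma>, norm x *\<^sub>R oone, y1, z1)"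
    by (simp add: T1_def P' a)
  have T1: "herm_automorphism T1 (triality a)"
    using herm_automorphism_triality [of "oconj a"] a(1) by (simp add: T1_def)
  note eqs = projectionsD [OF P [unfolded P']]
  define r where "r = sqrt (\<alpha> + \<beta>)"
  have r: "r > 0" "r\<^sup>2 = \<alpha> + \<beta>" using eqs(1-4) by (simp_all add: r_def)
  \<comment> \<open>The first two coordinates are now proportional to
    \<open>(sqrt \<alpha>, sqrt \<beta>)\<close>, and this rotation sends that vector to
    \<open>(r, 0)\<close>.\<close>
  define c s where "c = sqrt \<alpha> / r" and "s = - sqrt \<beta> / r"
  have cs: "c\<^sup>2 + s\<^sup>2 = 1"
    using r eqs(2,3) by (simp add: c_def s_def power_divide flip: add_divide_distrib r(2))
  define T2 where "T2 = rotation c s"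
  have T2: "herm_automorphism T2 (rotation c (- s))"
    using herm_automorphism_rotation [OF cs] by (simp add: T2_def)
  have "\<beta> + s * (s * (\<alpha> - \<beta>) + 2 * c * norm x) = 0"
  proof -
    have "c * r = sqrt \<alpha>" "s * r = - sqrt \<beta>" "(sqrt \<alpha>)\<^sup>2 = \<alpha>" "(sqrt \<beta>)\<^sup>2 = \<beta>"
      using r(1) eqs(2,3) by (simp_all add: c_def s_def)
    note sqrts = this norm_entry [OF eqs(5)]
    have "r\<^sup>2 * (\<beta> + s * (s * (\<alpha> - \<beta>) + 2 * c * norm x)) =
        r\<^sup>2 * \<beta> + (s * r)\<^sup>2 * (\<alpha> - \<beta>) + 2 * (s * r) * (c * r) * norm x"
      by (simp add: power2_eq_square algebra_simps)
    also have "\<dots> = (\<alpha> + \<beta>) * \<beta> + (sqrt \<beta>)\<^sup>2 * (\<alpha> - \<beta>) - 2 * (sqrt \<alpha>)\<^sup>2 * (sqrt \<beta>)\<^sup>2"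
      unfolding sqrts(1,2,5) r(2) by algebra
    also have "\<dots> = 0"
      unfolding sqrts(3,4) by (simp add: algebra_simps)
    finally have "r\<^sup>2 * (\<beta> + s * (s * (\<alpha> - \<beta>) + 2 * c * norm x)) = 0" .
    thus ?thesis using r(1) by simp
  qed
  then obtain \<alpha>2 \<gamma>2 x2 y2 z2 where P2: "T2 (T1 P) = (\<alpha>2, 0, \<gamma>2, x2, y2, z2)"
    by (simp add: T2_def P1)
  have "T2 (T1 P) \<in> projections"
    using T1 T2 P by (simp add: herm_automorphism_def)
  note eqs2 = projectionsD [OF this [unfolded P2]]
  \<comment> \<open>A zero diagonal entry kills its row and column, by the norm relations.\<close>
  have x2: "x2 = 0" "z2 = 0" using eqs2(5,7) by simp_all
  obtain b where b: "b \<bullet> b = 1" "b \<odot> y2 = norm y2 *\<^sub>R oone"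
    by (rule unit_multiple_exists)
  define T3 where "T3 = triality b"
  have P3: "T3 (T2 (T1 P)) = (\<alpha>2, 0, \<gamma>2, 0, norm y2 *\<^sub>R oone, 0)"
    by (simp add: T3_def P2 b x2)
  have T3: "herm_automorphism T3 (triality (oconj b))"
    using herm_automorphism_triality b(1) by (simp add: T3_def)
  \<comment> \<open>With \<beta> = 0 the matrix satisfies \<open>\<alpha>2 - \<gamma>2 = 1\<close>,
    and this boost sends \<open>(sqrt \<alpha>2, sqrt \<gamma>2)\<close> to
    \<open>(1, 0)\<close>.\<close>
  define T4 where "T4 = boost (sqrt \<alpha>2) (- sqrt \<gamma>2)"
  have T4: "herm_automorphism T4 (boost (sqrt \<alpha>2) (sqrt \<gamma>2))"
    using herm_automorphism_boost [of "sqrt \<alpha>2" "- sqrt \<gamma>2"] eqs2(1-4) by (simp add: T4_def)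
  have "T4 (T3 (T2 (T1 P))) = (1, 0, 0, 0, 0, 0)"
  proof -
    define A G where AG: "A = sqrt \<alpha>2" "G = sqrt \<gamma>2"
    have "\<alpha>2 = A\<^sup>2" "\<gamma>2 = G\<^sup>2" "A\<^sup>2 - G\<^sup>2 = 1" "norm y2 = A * G"
      using eqs2(1,2,4) norm_entry [OF eqs2(6)] by (simp_all add: AG)
    hence "- G * (- G * (\<alpha>2 + \<gamma>2) + 2 * A * norm y2) = - \<gamma>2"
      "- G * (A * (\<alpha>2 + \<gamma>2) + 2 * - G * norm y2) = - norm y2"
      by algebra+
    moreover have "(norm y2 *\<^sub>R oone) \<bullet> oone = norm y2" by simp
    ultimately show ?thesis
      unfolding P3 T4_def boost.simps AG [symmetric]
      using eqs2(1) by (simp only:) simp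
  qed
  moreover have "herm_automorphism (T4 \<circ> (T3 \<circ> (T2 \<circ> T1)))
      (((triality a \<circ> rotation c (- s)) \<circ> triality (oconj b)) \<circ> boost (sqrt \<alpha>2) (sqrt \<gamma>2))"
    using T1 T2 T3 T4 by (intro herm_automorphism_compose)
  ultimately show ?thesis by (metis comp_apply)
qed

theorem theorem7p3:
  shows "\<forall>p\<in>OP11. \<forall>q\<in>OP11. \<exists>F. isometry F \<and> F p = q"
proof (intro ballI)
  fix p q assume "p \<in> OP11" "q \<in> OP11"
  then obtain P Q where PQ: "p = point P" "q = point Q" "P \<in> projections" "Q \<in> projections"
    by (auto simp: OP11_eq)
  then obtain S S' T T' where
    S: "herm_automorphism S S'" "S P = (1, 0, 0, 0, 0, 0)" and
    T: "herm_automorphism T T'" "T Q = (1, 0, 0, 0, 0, 0)"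
    using herm_automorphism_to_origin by metis
  \<comment> \<open>Both matrices are sent to that of \<open>[1, 0, 0]\<close>, so going there by
    \<open>S\<close> and back by \<open>T'\<close> joins them.\<close>
  have "(T' \<circ> S) P = Q"
    using S T unfolding herm_automorphism_def by (metis comp_apply)
  moreover have "herm_automorphism (T' \<circ> S) (S' \<circ> T)"
    using S T herm_automorphism_compose herm_automorphism_sym by blast
  ultimately show "\<exists>F. isometry F \<and> F p = q"
    using isometry_induced PQ by metis
qed

end
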